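(* Let $g_1:[x_0,x_1]\to\mathbb{R}$ and $g_2:[x_0',x_1']\to\mathbb{R}$ be two strictly concave continuous functions, each differentiable except at the right endpoint of its interval, with $g_1'(x_0)=0$, $g_2'(x_0')=0$, and with vertical tangent line at the right endpoint ($g_1'(x_1^-)=-\infty$, $g_2'(x_1'^-)=-\infty$). Let $\gamma_{a,b}$ and $\delta_{a,b}$ be the coefficients of the supporting lines $ax+by=\gamma_{a,b}$ and $ax+by=\delta_{a,b}$ for the graphs of $g_1$ and $g_2$, respectively. Then $$\sum_{\substack{a,b,c,d\in\mathbb{Z}_{\ge0}\\ ad-bc=1}}(\gamma_{a,b}+\gamma_{c,d}-\gamma_{a+c,b+d})(\delta_{a,b}+\delta_{c,d}-\delta_{a+c,b+d})$$ is equal to the mixed area of the $g_1$-triangle and the $g_2$-triangle.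
   Context: For a function $g:[x_0,x_1]\to\mathbb{R}$ that is strictly concave and continuous on $[x_0,x_1]$, differentiable on $[x_0,x_1)$, with $g'(x_0)=0$ and $g'(x_1^-)=-\infty$, the $g$-triangle is the curvilinear triangle with vertices $(x_0,g(x_0))$, $(x_1,g(x_0))$, $(x_1,g(x_1))$, where $(x_0,g(x_0))$ and $(x_1,g(x_1))$ are connected by the graph of $g$ and the two other sides are a horizontal and a vertical straight segment. For a primitive vector $(a,b)\in\mathbb{Z}_{\ge0}^2$, the supporting line of the graph of $g$ orthogonal to $(a,b)$ is the line $ax+by=\gamma_{a,b}$ that touches the graph, the graph lying in the half-plane $ax+by\le\gamma_{a,b}$. The mixed area of the $g_1$-triangle and the $g_2$-triangle is taken to be the coefficient of $\epsilon$ (with no factor $1/2$) in $\mathrm{Area}(X)$, where $X$ denotes the Minkowski sum of the $g_1$-triangle and the $g_2$-triangle scaled by $\epsilon$; here $X$ is regarded as again a $g$-triangle for some function $g$, whose supporting-line coefficient in direction $(a,b)$ is $\gamma_{a,b}+\epsilon\delta_{a,b}$. *)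

theory Defs
  imports "HOL-Analysis.Analysis" "HOL-Computational_Algebra.Polynomial"
begin

definition strictly_concave_on :: "real set \<Rightarrow> (real \<Rightarrow> real) \<Rightarrow> bool" where
  "strictly_concave_on S g \<longleftrightarrow> convex S \<and>
     (\<forall>x\<in>S. \<forall>y\<in>S. \<forall>t. x \<noteq> y \<and> 0 < t \<and> t < 1 \<longrightarrow>
        (1 - t) * g x + t * g y < g ((1 - t) * x + t * y))"

definition triangle_function :: "real \<Rightarrow> real \<Rightarrow> (real \<Rightarrow> real) \<Rightarrow> bool" where
  "triangle_function x0 x1 g \<longleftrightarrow>
     x0 < x1 \<and>
     strictly_concave_on {x0..x1} g \<and>
     continuous_on {x0..x1} g \<and>
     (\<forall>x\<in>{x0..<x1}. g differentiable (at x within {x0..x1})) \<and>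
     (g has_real_derivative 0) (at x0 within {x0..x1}) \<and>
     filterlim (deriv g) at_bot (at_left x1)"

text \<open>The corner \<open>(x1, g x0)\<close> lies above the graph of the (decreasing) function \<open>g\<close>, so the
  curvilinear triangle is the region between the graph and the horizontal line \<open>y = g x0\<close>.\<close>

definition g_triangle :: "real \<Rightarrow> real \<Rightarrow> (real \<Rightarrow> real) \<Rightarrow> (real \<times> real) set" where
  "g_triangle x0 x1 g = {(x, y). x0 \<le> x \<and> x \<le> x1 \<and> g x \<le> y \<and> y \<le> g x0}"

definition supporting_line ::
    "real \<Rightarrow> real \<Rightarrow> (real \<Rightarrow> real) \<Rightarrow> nat \<Rightarrow> nat \<Rightarrow> real \<Rightarrow> bool" where
  "supporting_line x0 x1 g a b \<gamma> \<longleftrightarrow>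
     (\<forall>x\<in>{x0..x1}. real a * x + real b * g x \<le> \<gamma>) \<and>
     (\<exists>x\<in>{x0..x1}. real a * x + real b * g x = \<gamma>)"

definition subgraph :: "real \<Rightarrow> real \<Rightarrow> (real \<Rightarrow> real) \<Rightarrow> (real \<times> real) set" where
  "subgraph x0 x1 g = {(x, y). x0 \<le> x \<and> x \<le> x1 \<and> y \<le> g x}"

text \<open>The sum of the \<open>g1\<close>-triangle and of the \<open>g2\<close>-triangle scaled by \<open>\<epsilon>\<close>.
  A \<open>g\<close>-triangle lies on the non-convex side of its curved edge, and the pointwise sum of two
  such sets is not of the same form. The Minkowski sum is therefore taken on the convex side:
  the sum is the \<open>g\<close>-triangle for which the region below the graph of \<open>g\<close> is the Minkowski sum of
  the regions below the graphs of \<open>g1\<close> and (scaled by \<open>\<epsilon>\<close>) of \<open>g2\<close>.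
  The coefficients of the supporting lines then add up as \<open>\<gamma> + \<epsilon> * \<delta>\<close>;
  see \<open>triangle_sum_supporting_line\<close> below.\<close>

definition triangle_sum ::
    "real \<Rightarrow> real \<Rightarrow> (real \<Rightarrow> real) \<Rightarrow> real \<Rightarrow> real \<Rightarrow> (real \<Rightarrow> real) \<Rightarrow> real \<Rightarrow>
     real \<Rightarrow> real \<Rightarrow> (real \<Rightarrow> real) \<Rightarrow> bool" where
  "triangle_sum x0 x1 g1 x0' x1' g2 \<epsilon> y0 y1 g \<longleftrightarrow>
     triangle_function y0 y1 g \<and>
     subgraph y0 y1 g =
       {p + \<epsilon> *\<^sub>R q | p q. p \<in> subgraph x0 x1 g1 \<and> q \<in> subgraph x0' x1' g2}"

text \<open>The coefficient of \<open>\<epsilon>\<close> in the area of the sum, without the factor \<open>1/2\<close>. The sum is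
  unique by \<open>triangle_sum_unique\<close>, and a polynomial is determined by its values at \<open>\<epsilon> > 0\<close>.\<close>

definition has_mixed_area ::
    "real \<Rightarrow> real \<Rightarrow> (real \<Rightarrow> real) \<Rightarrow> real \<Rightarrow> real \<Rightarrow> (real \<Rightarrow> real) \<Rightarrow> real \<Rightarrow> bool" where
  "has_mixed_area x0 x1 g1 x0' x1' g2 M \<longleftrightarrow>
     (\<exists>p :: real poly.
        (\<forall>\<epsilon>>0. \<exists>y0 y1 g. triangle_sum x0 x1 g1 x0' x1' g2 \<epsilon> y0 y1 g \<and>
           measure lborel (g_triangle y0 y1 g) = poly p \<epsilon>) \<and>
        coeff p 1 = M)"

lemma triangle_sum_supporting_line:
  assumes sum: "triangle_sum x0 x1 g1 x0' x1' g2 \<epsilon> y0 y1 g" and "\<epsilon> > 0"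
    and s1: "supporting_line x0 x1 g1 a b \<gamma>" and s2: "supporting_line x0' x1' g2 a b \<delta>"
  shows "supporting_line y0 y1 g a b (\<gamma> + \<epsilon> * \<delta>)"
proof -
  have eq: "subgraph y0 y1 g =
      {p + \<epsilon> *\<^sub>R q | p q. p \<in> subgraph x0 x1 g1 \<and> q \<in> subgraph x0' x1' g2}"
    using sum by (simp add: triangle_sum_def)
  have le: "real a * z + real b * g z \<le> \<gamma> + \<epsilon> * \<delta>" if "z \<in> {y0..y1}" for z
  proof -
    have "(z, g z) \<in> subgraph y0 y1 g" using that by (simp add: subgraph_def)
    then obtain u v u' v' where uv: "(u, v) \<in> subgraph x0 x1 g1" "(u', v') \<in> subgraph x0' x1' g2"
      and z: "z = u + \<epsilon> * u'" "g z = v + \<epsilon> * v'"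
      unfolding eq by auto
    have "real a * u + real b * v \<le> real a * u + real b * g1 u"
      using uv by (auto simp: subgraph_def intro: mult_left_mono)
    also have "\<dots> \<le> \<gamma>" using s1 uv by (auto simp: subgraph_def supporting_line_def)
    finally have 1: "real a * u + real b * v \<le> \<gamma>" .
    have "real a * u' + real b * v' \<le> real a * u' + real b * g2 u'"
      using uv by (auto simp: subgraph_def intro: mult_left_mono)
    also have "\<dots> \<le> \<delta>" using s2 uv by (auto simp: subgraph_def supporting_line_def)
    finally have "\<epsilon> * (real a * u' + real b * v') \<le> \<epsilon> * \<delta>"
      using \<open>\<epsilon> > 0\<close> by simp
    with 1 show ?thesis unfolding z(2) by (simp add: z(1) algebra_simps)
  qed
  obtain u where u: "u \<in> {x0..x1}" "real a * u + real b * g1 u = \<gamma>"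
    using s1 by (auto simp: supporting_line_def)
  obtain u' where u': "u' \<in> {x0'..x1'}" "real a * u' + real b * g2 u' = \<delta>"
    using s2 by (auto simp: supporting_line_def)
  have "(u, g1 u) + \<epsilon> *\<^sub>R (u', g2 u') \<in> subgraph y0 y1 g"
    unfolding eq using u u' by (force simp: subgraph_def)
  then have z: "u + \<epsilon> * u' \<in> {y0..y1}" "g1 u + \<epsilon> * g2 u' \<le> g (u + \<epsilon> * u')"
    by (auto simp: subgraph_def)
  have "\<gamma> + \<epsilon> * \<delta> = real a * (u + \<epsilon> * u') + real b * (g1 u + \<epsilon> * g2 u')"
    by (simp add: u(2)[symmetric] u'(2)[symmetric] algebra_simps)
  also have "\<dots> \<le> real a * (u + \<epsilon> * u') + real b * g (u + \<epsilon> * u')"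
    using z(2) by (simp add: mult_left_mono)
  finally show ?thesis
    using le z(1) unfolding supporting_line_def by (meson order_antisym)
qed

lemma triangle_sum_unique:
  assumes "triangle_sum x0 x1 g1 x0' x1' g2 \<epsilon> y0 y1 g"
    and "triangle_sum x0 x1 g1 x0' x1' g2 \<epsilon> z0 z1 h"
  shows "g_triangle y0 y1 g = g_triangle z0 z1 h"
proof -
  have eq: "subgraph y0 y1 g = subgraph z0 z1 h" and "y0 < y1" "z0 < z1"
    using assms by (auto simp: triangle_sum_def triangle_function_def)
  have fst_subgraph: "fst ` subgraph u v f = {u..v}" for u v f
    by (force simp: subgraph_def)
  have "{y0..y1} = {z0..z1}"
    using eq fst_subgraph by metis
  then have ends: "y0 = z0" "y1 = z1"
    using \<open>y0 < y1\<close> \<open>z0 < z1\<close> by (auto simp: Icc_eq_Icc)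
  have "g x = h x" if "x \<in> {y0..y1}" for x
  proof (rule antisym)
    have "(x, g x) \<in> subgraph y0 y1 g" using that by (simp add: subgraph_def)
    then have "(x, g x) \<in> subgraph z0 z1 h" by (simp add: eq)
    then show "g x \<le> h x" by (simp add: subgraph_def)
    have "(x, h x) \<in> subgraph z0 z1 h" using that ends by (simp add: subgraph_def)
    then have "(x, h x) \<in> subgraph y0 y1 g" by (simp add: eq)
    then show "h x \<le> g x" by (simp add: subgraph_def)
  qed
  then show ?thesis
    using ends \<open>y0 < y1\<close> by (auto simp: g_triangle_def)
qed

end

theory Submission
  imports Defs
begin

text \<open>Twice the area of a \<open>g\<close>-triangle is the sum of the squares of
  \<open>\<gamma> a b + \<gamma> c d - \<gamma> (a + c) (b + d)\<close> over all unimodular pairs \<open>(a, b), (c, d)\<close>. Starting from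
  the corner bounded by the horizontal and the vertical side, cut corners repeatedly: the supporting
  line orthogonal to \<open>(a + c, b + d)\<close> cuts off from the corner formed by the supporting lines
  orthogonal to \<open>(a, b)\<close> and \<open>(c, d)\<close> a triangle which is unimodularly equivalent to a right
  isosceles triangle with legs \<open>\<gamma> a b + \<gamma> c d - \<gamma> (a + c) (b + d)\<close>. A point \<open>p\<close> lies in this
  triangle iff the sublinear function \<open>(a, b) \<mapsto> \<gamma> a b - (a, b) \<bullet> p\<close> is nonnegative at \<open>(a, b)\<close>
  and \<open>(c, d)\<close> and negative at their mediant. A sublinear function that is nonnegative at \<open>(1, 0)\<close>
  and \<open>(0, 1)\<close> and negative somewhere changes its sign in this way at exactly one pair, so the
  triangles are disjoint and exhaust the \<open>g\<close>-triangle up to a null set.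

  Applied to the sum of the \<open>g1\<close>-triangle and the \<open>\<epsilon>\<close>-scaled \<open>g2\<close>-triangle, whose coefficients
  are \<open>\<gamma> + \<epsilon> * \<delta>\<close>, this gives an area that is quadratic in \<open>\<epsilon>\<close> with the claimed linear coefficient.
  The sum is again a \<open>g\<close>-triangle because a supergradient of the sup-convolution of \<open>g1\<close> and the
  scaled \<open>g2\<close> is a common supergradient of \<open>g1\<close> and \<open>g2\<close> at the two points of the optimal
  decomposition.\<close>

section \<open>Supergradients\<close>

lemma strictly_concave_onD:
  assumes "strictly_concave_on S g" "x \<in> S" "y \<in> S" "x \<noteq> y" "0 < t" "t < 1"
  shows "(1 - t) * g x + t * g y < g ((1 - t) * x + t * y)"
  using assms by (auto simp: strictly_concave_on_def)

lemma strictly_concave_on_imp_concave_on: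
  assumes "strictly_concave_on S g"
  shows "concave_on S g"
proof (rule concave_on_linorderI)
  fix t x y :: real
  assume "0 < t" "t < 1" "x \<in> S" "y \<in> S" "x < y"
  then show "(1 - t) * g x + t * g y \<le> g ((1 - t) *\<^sub>R x + t *\<^sub>R y)"
    using assms by (auto simp: strictly_concave_on_def intro: less_imp_le)
qed (use assms in \<open>simp add: strictly_concave_on_def\<close>)

definition supergradient :: "real set \<Rightarrow> (real \<Rightarrow> real) \<Rightarrow> real \<Rightarrow> real \<Rightarrow> bool" where
  "supergradient S g x m \<longleftrightarrow> (\<forall>y\<in>S. g y \<le> g x + m * (y - x))"

lemma supergradientD: "supergradient S g x m \<Longrightarrow> y \<in> S \<Longrightarrow> g y \<le> g x + m * (y - x)"
  by (simp add: supergradient_def)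

lemma supergradient_antimono:
  assumes "supergradient S g x m" "supergradient S g y k" "x \<in> S" "y \<in> S" "x < y"
  shows "k \<le> m"
proof -
  have "g y \<le> g x + m * (y - x)" "g x \<le> g y + k * (x - y)"
    using assms by (simp_all add: supergradientD)
  then have "k * (y - x) \<le> m * (y - x)"
    by (simp add: algebra_simps)
  then show ?thesis
    using \<open>x < y\<close> by simp
qed

lemma derivative_nonneg_at_left_minimum:
  fixes \<phi> :: "real \<Rightarrow> real"
  assumes deriv: "(\<phi> has_real_derivative D) (at a within {a..b})" and "a < b"
    and minimum: "\<And>t. t \<in> {a..b} \<Longrightarrow> \<phi> a \<le> \<phi> t"
  shows "0 \<le> D"
proof (rule ccontr)
  assume "\<not> 0 \<le> D"
  then obtain d where "d > 0"
    and decreasing: "\<forall>h>0. a + h \<in> {a..b} \<longrightarrow> h < d \<longrightarrow> \<phi> (a + h) < \<phi> a"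
    using has_real_derivative_neg_dec_right[OF deriv] by auto
  define h where "h = min (b - a) (d / 2)"
  have h: "0 < h" "a + h \<in> {a..b}" "h < d"
    using \<open>d > 0\<close> \<open>a < b\<close> by (auto simp: h_def)
  then have "\<phi> (a + h) < \<phi> a"
    using decreasing by blast
  with minimum[OF h(2)] show False by simp
qed

lemma has_real_derivative_along_segment:
  fixes g :: "real \<Rightarrow> real"
  assumes deriv: "(g has_real_derivative D) (at x within S)" and sub: "closed_segment x y \<subseteq> S"
  shows "((\<lambda>t. g ((1 - t) * x + t * y)) has_real_derivative D * (y - x)) (at 0 within {0..1})"
proof -
  let ?l = "\<lambda>t. (1 - t) * x + t * y"
  have "?l ` {0..1} \<subseteq> S"
    using sub by (simp add: closed_segment_image_interval)
  then have "(g has_real_derivative D) (at (?l 0) within ?l ` {0..1})"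
    using deriv by (auto intro: DERIV_subset)
  moreover have "(?l has_real_derivative y - x) (at 0 within {0..1})"
    by (auto intro!: derivative_eq_intros)
  ultimately have "((g \<circ> ?l) has_real_derivative D * (y - x)) (at 0 within {0..1})"
    by (rule DERIV_image_chain)
  then show ?thesis by (simp add: o_def)
qed

lemma concave_on_derivative_supergradient:
  assumes g: "concave_on S g" and "x \<in> S"
    and deriv: "(g has_real_derivative m) (at x within S)"
  shows "supergradient S g x m"
  unfolding supergradient_def
proof
  fix y assume "y \<in> S"
  let ?\<phi> = "\<lambda>t. g ((1 - t) * x + t * y) - t * (g y - g x)"
  have "closed_segment x y \<subseteq> S"
    using concave_on_imp_convex[OF g] \<open>x \<in> S\<close> \<open>y \<in> S\<close> by (rule closed_segment_subset[rotated 2])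
  note derivative_along = has_real_derivative_along_segment[OF deriv this]
  have "(?\<phi> has_real_derivative m * (y - x) - (g y - g x)) (at 0 within {0..1})"
    by (auto intro!: derivative_eq_intros derivative_along)
  moreover have "?\<phi> 0 \<le> ?\<phi> t" if "t \<in> {0..1}" for t
    using concave_onD[OF g, of t x y] that \<open>x \<in> S\<close> \<open>y \<in> S\<close> by (simp add: algebra_simps)
  ultimately have "0 \<le> m * (y - x) - (g y - g x)"
    by (rule derivative_nonneg_at_left_minimum[OF _ zero_less_one])
  then show "g y \<le> g x + m * (y - x)" by simp
qed

lemma concave_on_ex_supergradient:
  assumes "concave_on S g" "x \<in> interior S"
  shows "\<exists>m. supergradient S g x m"
proof -
  obtain k where k: "- g x + k * (y - x) \<le> - g y" if "y \<in> S" for y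
    using convex_le_Inf_differential[of S "\<lambda>x. - g x" x] assms by (auto simp: concave_on_def)
  have "supergradient S g x (- k)"
    unfolding supergradient_def using k by (force simp: algebra_simps)
  then show ?thesis ..
qed

lemma supergradient_directional_derivative_le:
  assumes sup: "supergradient S g x m" and deriv: "(g has_real_derivative D) (at x within S)"
    and sub: "closed_segment x y \<subseteq> S"
  shows "D * (y - x) \<le> m * (y - x)"
proof -
  let ?\<phi> = "\<lambda>t. t * m * (y - x) - g ((1 - t) * x + t * y)"
  have "(?\<phi> has_real_derivative m * (y - x) - D * (y - x)) (at 0 within {0..1})"
    by (auto intro!: derivative_eq_intros has_real_derivative_along_segment[OF deriv sub])
  moreover have "?\<phi> 0 \<le> ?\<phi> t" if "t \<in> {0..1}" for t
  proof -
    have "(1 - t) * x + t * y \<in> S"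
      using sub that by (auto simp: closed_segment_def)
    from supergradientD[OF sup this] show ?thesis
      by (simp add: algebra_simps)
  qed
  ultimately have "0 \<le> m * (y - x) - D * (y - x)"
    by (rule derivative_nonneg_at_left_minimum[OF _ zero_less_one])
  then show ?thesis by simp
qed

lemma has_real_derivative_sandwich:
  assumes "(f has_real_derivative m) (at x within S)" "(h has_real_derivative m) (at x within S)"
    and le: "\<And>y. y \<in> S \<Longrightarrow> f y \<le> g y" "\<And>y. y \<in> S \<Longrightarrow> g y \<le> h y"
    and eq: "f x = g x" "h x = g x"
  shows "(g has_real_derivative m) (at x within S)"
proof -
  define remainder where "remainder k y = (k y - k x - m * (y - x)) / \<bar>y - x\<bar>"
    for k :: "real \<Rightarrow> real" and y
  have iff: "(k has_real_derivative m) (at x within S) \<longleftrightarrow>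
      (remainder k \<longlongrightarrow> 0) (at x within S)" for k
    unfolding has_field_derivative_def has_derivative_within remainder_def
    by (simp add: bounded_linear_mult_right divide_inverse diff_diff_eq mult.commute)
  have "remainder f y \<le> remainder g y" "remainder g y \<le> remainder h y"
    if "y \<in> S" for y
    using le[OF that] eq by (auto simp: remainder_def intro!: divide_right_mono)
  then have "\<forall>\<^sub>F y in at x within S. remainder f y \<le> remainder g y"
    "\<forall>\<^sub>F y in at x within S. remainder g y \<le> remainder h y"
    by (auto simp: eventually_at_filter)
  then show ?thesis
    using assms(1,2) unfolding iff by (rule tendsto_sandwich)
qed

section \<open>Triangle functions\<close>

locale triangle =
  fixes x0 x1 :: real and g :: "real \<Rightarrow> real"
  assumes triangle_function: "triangle_function x0 x1 g"
begin

lemma left_less_right: "x0 < x1"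
  and strictly_concave: "strictly_concave_on {x0..x1} g"
  and continuous: "continuous_on {x0..x1} g"
  and derivative_left: "(g has_real_derivative 0) (at x0 within {x0..x1})"
  and deriv_at_bot: "filterlim (deriv g) at_bot (at_left x1)"
  using triangle_function by (auto simp: triangle_function_def)

lemmas concave = strictly_concave_on_imp_concave_on[OF strictly_concave]

lemma ex_derivative:
  assumes "x \<in> {x0..<x1}"
  obtains D where "(g has_real_derivative D) (at x within {x0..x1})"
  using assms triangle_function unfolding triangle_function_def real_differentiable_def by blast

lemma le_left:
  assumes "x \<in> {x0..x1}"
  shows "g x \<le> g x0"
  using concave_on_derivative_supergradient[OF concave _ derivative_left] assms left_less_right
  by (auto dest: supergradientD)

lemma less_left:
  assumes x: "x \<in> {x0<..x1}"
  shows "g x < g x0"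
proof -
  have "(1 - 1/2) * g x0 + 1/2 * g x < g ((1 - 1/2) * x0 + 1/2 * x)"
    using x by (intro strictly_concave_onD[OF strictly_concave]) auto
  moreover have "g ((1 - 1/2) * x0 + 1/2 * x) \<le> g x0"
    using x by (intro le_left) auto
  ultimately show ?thesis by simp
qed

lemma supergradient_nonneg_imp_left:
  assumes "supergradient {x0..x1} g x m" "x \<in> {x0..x1}" "0 \<le> m"
  shows "x = x0"
proof (rule ccontr)
  assume "x \<noteq> x0"
  have "g x0 \<le> g x + m * (x0 - x)"
    using assms left_less_right by (intro supergradientD) auto
  also have "\<dots> \<le> g x"
    using assms by (simp add: mult_nonneg_nonpos)
  also have "\<dots> < g x0"
    using assms \<open>x \<noteq> x0\<close> by (intro less_left) auto
  finally show False by simp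
qed

lemma supergradient_left_nonneg:
  assumes m: "supergradient {x0..x1} g x0 m"
  shows "0 \<le> m"
proof -
  have "0 * (x1 - x0) \<le> m * (x1 - x0)"
    using derivative_left left_less_right
    by (intro supergradient_directional_derivative_le[OF m]) (auto simp: closed_segment_eq_real_ivl)
  then show ?thesis
    using left_less_right by (simp add: zero_le_mult_iff)
qed

lemma not_supergradient_right: "\<not> supergradient {x0..x1} g x1 m"
proof
  assume m: "supergradient {x0..x1} g x1 m"
  have "\<forall>\<^sub>F x in at_left x1. deriv g x < m"
    using deriv_at_bot by (simp add: filterlim_at_bot_dense)
  moreover have "\<forall>\<^sub>F x in at_left x1. x \<in> {x0<..<x1}"
    using eventually_at_left_real[OF left_less_right] .
  ultimately have "\<forall>\<^sub>F x in at_left x1. deriv g x < m \<and> x \<in> {x0<..<x1}"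
    by (rule eventually_conj)
  then obtain x where x: "deriv g x < m" "x \<in> {x0<..<x1}"
    using eventually_happens'[OF trivial_limit_at_left_real] by blast
  obtain D where D: "(g has_real_derivative D) (at x within {x0..x1})"
    using x ex_derivative[of x] by auto
  have "m \<le> D"
    using concave_on_derivative_supergradient[OF concave _ D] m x
    by (intro supergradient_antimono[of "{x0..x1}" g x D x1]) auto
  moreover have "deriv g x = D"
    using D x by (simp add: at_within_Icc_at DERIV_imp_deriv)
  ultimately show False using x by simp
qed

lemma supergradient_imp_less_right:
  assumes "supergradient {x0..x1} g x m" "x \<in> {x0..x1}"
  shows "x < x1"
  using assms not_supergradient_right by (cases "x = x1") auto

lemma supergradient_imp_derivative:
  assumes m: "supergradient {x0..x1} g x m" "x \<in> {x0..x1}" "m \<le> 0"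
  shows "(g has_real_derivative m) (at x within {x0..x1})"
proof (cases "x = x0")
  case True
  have "0 \<le> m"
    using m(1) unfolding True by (rule supergradient_left_nonneg)
  then show ?thesis
    using m True derivative_left by simp
next
  case False
  have "x < x1"
    using m by (intro supergradient_imp_less_right)
  then obtain D where D: "(g has_real_derivative D) (at x within {x0..x1})"
    using m ex_derivative[of x] by auto
  have "D * (y - x) \<le> m * (y - x)" if "y \<in> {x0..x1}" for y
    using m that
    by (intro supergradient_directional_derivative_le[OF m(1) D])
      (auto simp: closed_segment_eq_real_ivl)
  from this[of x0] this[of x1] have "D = m"
    using m False \<open>x < x1\<close> by (auto simp: mult_le_cancel_right)
  with D show ?thesis by simp
qed

end

section \<open>The sum of two triangles\<close>

lemma add_scaled_mem_Icc:
  fixes \<epsilon> :: real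
  assumes "s \<in> {x0..x1}" "t \<in> {x0'..x1'}" "\<epsilon> > 0"
  shows "s + \<epsilon> * t \<in> {x0 + \<epsilon> * x0'..x1 + \<epsilon> * x1'}"
  using assms by (auto intro!: add_mono mult_left_mono)

lemma ex_add_scaled_eq:
  fixes \<epsilon> :: real
  assumes z: "z \<in> {x0 + \<epsilon> * x0'..x1 + \<epsilon> * x1'}" and "x0 \<le> x1" "x0' \<le> x1'" "\<epsilon> > 0"
  shows "\<exists>s\<in>{x0..x1}. \<exists>t\<in>{x0'..x1'}. s + \<epsilon> * t = z"
proof -
  have "\<epsilon> * x0' \<le> \<epsilon> * x1'"
    using \<open>x0' \<le> x1'\<close> \<open>\<epsilon> > 0\<close> by simp
  then obtain s where "s \<in> {x0..x1}" "\<epsilon> * x0' \<le> z - s" "z - s \<le> \<epsilon> * x1'"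
    using z \<open>x0 \<le> x1\<close> by (intro that[of "max x0 (z - \<epsilon> * x1')"]) auto
  then have "s \<in> {x0..x1}" "(z - s) / \<epsilon> \<in> {x0'..x1'}" "s + \<epsilon> * ((z - s) / \<epsilon>) = z"
    using \<open>\<epsilon> > 0\<close> by (simp_all add: pos_divide_le_eq pos_le_divide_eq mult.commute)
  then show ?thesis by blast
qed

locale optimal_splitting = left: triangle x0 x1 g1 + right: triangle x0' x1' g2
  for x0 x1 g1 x0' x1' g2 +
  fixes \<epsilon> :: real and u v :: "real \<Rightarrow> real"
  assumes scale_pos: "\<epsilon> > 0"
    and splitting: "\<And>z. z \<in> {x0 + \<epsilon> * x0'..x1 + \<epsilon> * x1'} \<Longrightarrow>
      u z \<in> {x0..x1} \<and> v z \<in> {x0'..x1'} \<and> u z + \<epsilon> * v z = z"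
    and optimal: "\<And>s t. \<lbrakk>s \<in> {x0..x1}; t \<in> {x0'..x1'}\<rbrakk> \<Longrightarrow>
      g1 s + \<epsilon> * g2 t \<le> g1 (u (s + \<epsilon> * t)) + \<epsilon> * g2 (v (s + \<epsilon> * t))"
begin

abbreviation y0 where "y0 \<equiv> x0 + \<epsilon> * x0'"
abbreviation y1 where "y1 \<equiv> x1 + \<epsilon> * x1'"

definition sup_convolution :: "real \<Rightarrow> real" where
  "sup_convolution z = g1 (u z) + \<epsilon> * g2 (v z)"

lemma splitting_left_bounds:
  assumes z: "z \<in> {y0..y1}"
  shows "z - \<epsilon> * x1' \<le> u z" "u z \<le> z - \<epsilon> * x0'"
proof -
  have "u z + \<epsilon> * v z = z" "\<epsilon> * x0' \<le> \<epsilon> * v z" "\<epsilon> * v z \<le> \<epsilon> * x1'"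
    using splitting[OF z] scale_pos by (simp_all add: mult_left_mono)
  then show "z - \<epsilon> * x1' \<le> u z" "u z \<le> z - \<epsilon> * x0'"
    by linarith+
qed

lemma le_sup_convolution:
  assumes "s \<in> {x0..x1}" "t \<in> {x0'..x1'}"
  shows "g1 s + \<epsilon> * g2 t \<le> sup_convolution (s + \<epsilon> * t)"
  using optimal[OF assms] by (simp add: sup_convolution_def)

lemma sum_left_less_right: "y0 < y1"
  using left.left_less_right right.left_less_right scale_pos by (simp add: add_strict_mono)

lemma strictly_concave_sup_convolution: "strictly_concave_on {y0..y1} sup_convolution"
  unfolding strictly_concave_on_def
proof (intro conjI ballI allI impI)
  fix z w t :: real
  assume z: "z \<in> {y0..y1}" and w: "w \<in> {y0..y1}" and t: "z \<noteq> w \<and> 0 < t \<and> t < 1"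
  note z_split = splitting[OF z] and w_split = splitting[OF w]
  let ?u = "(1 - t) * u z + t * u w" and ?v = "(1 - t) * v z + t * v w"
  have weak: "(1 - t) * g1 (u z) + t * g1 (u w) \<le> g1 ?u"
    "(1 - t) * g2 (v z) + t * g2 (v w) \<le> g2 ?v"
    using concave_onD[OF left.concave, of t "u z" "u w"]
      concave_onD[OF right.concave, of t "v z" "v w"] z_split w_split t by auto
  have "u z \<noteq> u w \<or> v z \<noteq> v w"
    using z_split w_split t by auto
  then have "(1 - t) * g1 (u z) + t * g1 (u w) < g1 ?u \<or>
      (1 - t) * g2 (v z) + t * g2 (v w) < g2 ?v"
    using strictly_concave_onD[OF left.strictly_concave]
      strictly_concave_onD[OF right.strictly_concave] z_split w_split t by blast
  then have "(1 - t) * g1 (u z) + t * g1 (u w) + \<epsilon> * ((1 - t) * g2 (v z) + t * g2 (v w))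
      < g1 ?u + \<epsilon> * g2 ?v"
    using weak scale_pos by (auto intro: add_less_le_mono add_le_less_mono)
  also have "\<dots> \<le> sup_convolution (?u + \<epsilon> * ?v)"
    using z_split w_split t convexD_alt[OF convex_real_interval(5)]
    by (intro le_sup_convolution) fastforce+
  also have "?u + \<epsilon> * ?v = (1 - t) * (u z + \<epsilon> * v z) + t * (u w + \<epsilon> * v w)"
    by (simp add: algebra_simps)
  finally show "(1 - t) * sup_convolution z + t * sup_convolution w
      < sup_convolution ((1 - t) * z + t * w)"
    using z_split w_split by (simp add: sup_convolution_def algebra_simps)
qed simp

lemma supergradient_splitting:
  assumes m: "supergradient {y0..y1} sup_convolution z m" and z: "z \<in> {y0..y1}"
  shows "supergradient {x0..x1} g1 (u z) m" "supergradient {x0'..x1'} g2 (v z) m"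
proof -
  note split = splitting[OF z]
  have sup: "g1 s + \<epsilon> * g2 t \<le> g1 (u z) + \<epsilon> * g2 (v z) + m * ((s + \<epsilon> * t) - z)"
    if "s \<in> {x0..x1}" "t \<in> {x0'..x1'}" for s t
    using le_sup_convolution[OF that] supergradientD[OF m add_scaled_mem_Icc[OF that scale_pos]]
    by (simp add: sup_convolution_def)
  show "supergradient {x0..x1} g1 (u z) m"
    unfolding supergradient_def
  proof
    fix s assume "s \<in> {x0..x1}"
    then have "g1 s \<le> g1 (u z) + m * ((s + \<epsilon> * v z) - z)"
      using sup[of s "v z"] split by simp
    also have "(s + \<epsilon> * v z) - z = s - u z"
      using split by simp
    finally show "g1 s \<le> g1 (u z) + m * (s - u z)" .
  qed
  show "supergradient {x0'..x1'} g2 (v z) m"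
    unfolding supergradient_def
  proof
    fix t assume "t \<in> {x0'..x1'}"
    then have "\<epsilon> * g2 t \<le> \<epsilon> * g2 (v z) + m * ((u z + \<epsilon> * t) - z)"
      using sup[of "u z" t] split by simp
    also have "(u z + \<epsilon> * t) - z = \<epsilon> * (t - v z)"
      using split by (simp add: algebra_simps)
    finally have "\<epsilon> * g2 t \<le> \<epsilon> * (g2 (v z) + m * (t - v z))"
      by (simp add: algebra_simps)
    then show "g2 t \<le> g2 (v z) + m * (t - v z)"
      using scale_pos by simp
  qed
qed

lemma supergradient_nonneg_imp_left:
  assumes m: "supergradient {y0..y1} sup_convolution z m" and z: "z \<in> {y0..y1}" and "0 \<le> m"
  shows "z = y0"
proof -
  have "u z = x0" "v z = x0'"
    using supergradient_splitting[OF m z] splitting[OF z] \<open>0 \<le> m\<close>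
    by (auto intro: left.supergradient_nonneg_imp_left right.supergradient_nonneg_imp_left)
  then show ?thesis
    using splitting[OF z] by simp
qed

lemma supergradient_zero_left: "supergradient {y0..y1} sup_convolution y0 0"
proof -
  have "sup_convolution z \<le> sup_convolution y0" if "z \<in> {y0..y1}" for z
  proof -
    have "sup_convolution z \<le> g1 x0 + \<epsilon> * g2 x0'"
      using splitting[OF that] left.le_left right.le_left scale_pos
      by (auto simp: sup_convolution_def intro!: add_mono mult_left_mono)
    also have "\<dots> \<le> sup_convolution y0"
      using left.left_less_right right.left_less_right by (intro le_sup_convolution) auto
    finally show ?thesis .
  qed
  then show ?thesis
    by (simp add: supergradient_def)
qed

lemma ex_nonpos_supergradient:
  assumes z: "z \<in> {y0..<y1}"
  obtains m where "m \<le> 0" "supergradient {y0..y1} sup_convolution z m"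
proof (cases "z = y0")
  case True
  then show thesis
    using that supergradient_zero_left by blast
next
  case False
  then have "z \<in> interior {y0..y1}"
    using z by simp
  then obtain m where m: "supergradient {y0..y1} sup_convolution z m"
    using concave_on_ex_supergradient
      strictly_concave_on_imp_concave_on[OF strictly_concave_sup_convolution] by blast
  then have "m \<le> 0"
    using supergradient_nonneg_imp_left[of z m] z False by fastforce
  with m show thesis
    using that by blast
qed

lemma
  assumes m: "supergradient {y0..y1} sup_convolution z m" and z: "z \<in> {y0..y1}" and "m \<le> 0"
  shows supergradient_imp_splitting_less_right: "u z < x1"
    and supergradient_imp_left_derivative: "(g1 has_real_derivative m) (at (u z) within {x0..x1})"
  using supergradient_splitting[OF m z] splitting[OF z] \<open>m \<le> 0\<close>
  by (auto intro: left.supergradient_imp_less_right left.supergradient_imp_derivative)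

lemma at_within_translate:
  assumes m: "supergradient {y0..y1} sup_convolution z m" and z: "z \<in> {y0..y1}" and "m \<le> 0"
  shows "at z within {y0..y1} = at z within ({y0..y1} \<inter> {x0 + \<epsilon> * v z..x1 + \<epsilon> * v z})"
proof (cases "z = y0")
  case True
  have "u z = x0"
    using True splitting[OF z] splitting_left_bounds(2)[OF z]
    by (metis add_diff_cancel_right' atLeastAtMost_iff order_antisym)
  then have "\<epsilon> * v z = \<epsilon> * x0'"
    using True splitting[OF z] by linarith
  then show ?thesis
    using True left.left_less_right by (intro at_within_nhd[of _ "{..<x1 + \<epsilon> * v z}"]) auto
next
  case False
  have "u z \<noteq> x0"
  proof
    assume "u z = x0"
    then have "0 \<le> m"
      using supergradient_splitting(1)[OF m z] left.supergradient_left_nonneg by simp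
    with False show False
      using supergradient_nonneg_imp_left[OF m z] by simp
  qed
  then have "x0 + \<epsilon> * v z < z" "z < x1 + \<epsilon> * v z"
    using splitting[OF z] supergradient_imp_splitting_less_right[OF assms] by auto
  then show ?thesis
    by (intro at_within_nhd[of _ "{x0 + \<epsilon> * v z<..<x1 + \<epsilon> * v z}"]) auto
qed

text \<open>The graph of \<open>g1\<close>, translated with the second summand kept at \<open>v z\<close>, touches the
  sup-convolution from below, while the line with slope \<open>m\<close> touches it from above.\<close>

lemma supergradient_imp_derivative:
  assumes m: "supergradient {y0..y1} sup_convolution z m" and z: "z \<in> {y0..y1}" and "m \<le> 0"
  shows "(sup_convolution has_real_derivative m) (at z within {y0..y1})"
proof -
  define c where "c = \<epsilon> * v z"
  define Y where "Y = {y0..y1} \<inter> {x0 + c..x1 + c}"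
  have c: "z - c = u z"
    using splitting[OF z] by (simp add: c_def)
  have "(sup_convolution has_real_derivative m) (at z within Y)"
  proof (rule has_real_derivative_sandwich)
    have "(g1 has_real_derivative m) (at (z - c) within (\<lambda>w. w - c) ` Y)"
      unfolding c
      by (rule DERIV_subset[OF supergradient_imp_left_derivative[OF assms]]) (auto simp: Y_def)
    moreover have "((\<lambda>w. w - c) has_real_derivative 1) (at z within Y)"
      by (auto intro!: derivative_eq_intros)
    ultimately have "((g1 \<circ> (\<lambda>w. w - c)) has_real_derivative m * 1) (at z within Y)"
      by (rule DERIV_image_chain)
    then show "((\<lambda>w. g1 (w - c) + \<epsilon> * g2 (v z)) has_real_derivative m) (at z within Y)"
      by (auto simp: o_def intro!: derivative_eq_intros)
    show "((\<lambda>w. sup_convolution z + m * (w - z)) has_real_derivative m) (at z within Y)"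
      by (auto intro!: derivative_eq_intros)
    show "g1 (w - c) + \<epsilon> * g2 (v z) \<le> sup_convolution w" if "w \<in> Y" for w
      using le_sup_convolution[of "w - c" "v z"] that splitting[OF z] by (auto simp: Y_def c_def)
    show "sup_convolution w \<le> sup_convolution z + m * (w - z)" if "w \<in> Y" for w
      using that m by (auto simp: Y_def supergradient_def)
  qed (simp_all add: c sup_convolution_def)
  then show ?thesis
    unfolding at_within_translate[OF assms] by (simp add: Y_def c_def)
qed

lemma splitting_tendsto_right:
  "(u \<longlongrightarrow> x1) (at y1 within {y0..y1})" "(v \<longlongrightarrow> x1') (at y1 within {y0..y1})"
proof -
  have bounds: "z - \<epsilon> * x1' \<le> u z" "u z \<le> x1" "(z - x1) / \<epsilon> \<le> v z" "v z \<le> x1'"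
    if "z \<in> {y0..y1}" for z
  proof -
    have "z - x1 \<le> \<epsilon> * v z"
      using splitting[OF that] by (simp add: algebra_simps)
    then show "(z - x1) / \<epsilon> \<le> v z"
      using scale_pos by (simp add: pos_divide_le_eq mult.commute)
  qed (use splitting[OF that] splitting_left_bounds[OF that] in auto)
  have "((\<lambda>z. z - \<epsilon> * x1') \<longlongrightarrow> y1 - \<epsilon> * x1') (at y1 within {y0..y1})"
    by (intro tendsto_intros)
  then show "(u \<longlongrightarrow> x1) (at y1 within {y0..y1})"
    by (intro tendsto_sandwich[of "\<lambda>z. z - \<epsilon> * x1'" u _ "\<lambda>_. x1"])
      (auto simp: eventually_at_filter bounds)
  have "((\<lambda>z. (z - x1) / \<epsilon>) \<longlongrightarrow> (y1 - x1) / \<epsilon>) (at y1 within {y0..y1})"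
    using scale_pos by (intro tendsto_intros) auto
  then show "(v \<longlongrightarrow> x1') (at y1 within {y0..y1})"
    using scale_pos by (intro tendsto_sandwich[of "\<lambda>z. (z - x1) / \<epsilon>" v _ "\<lambda>_. x1'"])
      (auto simp: eventually_at_filter bounds)
qed

lemma continuous_sup_convolution: "continuous_on {y0..y1} sup_convolution"
  unfolding continuous_on_eq_continuous_within
proof
  fix z assume z: "z \<in> {y0..y1}"
  show "continuous (at z within {y0..y1}) sup_convolution"
  proof (cases "z = y1")
    case True
    have "y1 \<in> {y0..y1}"
      using sum_left_less_right by simp
    note split = splitting[OF this] splitting_left_bounds(1)[OF this]
    then have "u y1 = x1"
      by (metis add_diff_cancel_right' atLeastAtMost_iff order_antisym)
    moreover from this have "v y1 = x1'"
      using split scale_pos by simp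
    moreover have "((\<lambda>z. g1 (u z)) \<longlongrightarrow> g1 x1) (at y1 within {y0..y1})"
      using splitting left.left_less_right
      by (intro continuous_on_tendsto_compose[OF left.continuous splitting_tendsto_right(1)])
        (auto simp: eventually_at_filter)
    moreover have "((\<lambda>z. g2 (v z)) \<longlongrightarrow> g2 x1') (at y1 within {y0..y1})"
      using splitting right.left_less_right
      by (intro continuous_on_tendsto_compose[OF right.continuous splitting_tendsto_right(2)])
        (auto simp: eventually_at_filter)
    ultimately show ?thesis
      unfolding True continuous_within sup_convolution_def by (auto intro!: tendsto_intros)
  next
    case False
    with z obtain m where "m \<le> 0" "supergradient {y0..y1} sup_convolution z m"
      using ex_nonpos_supergradient[of z] by auto
    then show ?thesis
      using supergradient_imp_derivative z DERIV_continuous by blast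
  qed
qed

lemma filterlim_splitting_at_left: "filterlim u (at_left x1) (at_left y1)"
  unfolding filterlim_at
proof
  show "(u \<longlongrightarrow> x1) (at_left y1)"
    using splitting_tendsto_right(1) sum_left_less_right by (simp add: at_within_Icc_at_left)
  show "\<forall>\<^sub>F z in at_left y1. u z \<in> {..<x1} \<and> u z \<noteq> x1"
    using eventually_at_left_real[OF sum_left_less_right]
  proof (rule eventually_mono)
    fix z assume "z \<in> {y0<..<y1}"
    then show "u z \<in> {..<x1} \<and> u z \<noteq> x1"
      using ex_nonpos_supergradient[of z] supergradient_imp_splitting_less_right[of z] by fastforce
  qed
qed

lemma deriv_sup_convolution:
  assumes z: "z \<in> {y0<..<y1}" and "x0 < u z"
  shows "deriv sup_convolution z = deriv g1 (u z)"
proof -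
  obtain m where m: "m \<le> 0" "supergradient {y0..y1} sup_convolution z m"
    using ex_nonpos_supergradient[of z] z by auto
  have "deriv sup_convolution z = m"
    using supergradient_imp_derivative[OF m(2) _ m(1)] z
    by (simp add: at_within_Icc_at DERIV_imp_deriv)
  moreover have "deriv g1 (u z) = m"
    using supergradient_imp_left_derivative[OF m(2) _ m(1)]
      supergradient_imp_splitting_less_right[OF m(2) _ m(1)] z \<open>x0 < u z\<close>
    by (simp add: at_within_Icc_at DERIV_imp_deriv)
  ultimately show ?thesis by simp
qed

lemma deriv_sup_convolution_at_bot: "filterlim (deriv sup_convolution) at_bot (at_left y1)"
proof -
  have "x0 + \<epsilon> * x1' < y1"
    using left.left_less_right by simp
  from eventually_at_left_real[OF this]
  have deriv_eq: "\<forall>\<^sub>F z in at_left y1. deriv sup_convolution z = deriv g1 (u z)"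
  proof (rule eventually_mono)
    fix z assume z: "z \<in> {x0 + \<epsilon> * x1'<..<y1}"
    moreover have "y0 \<le> x0 + \<epsilon> * x1'"
      using right.left_less_right scale_pos by simp
    ultimately have "z \<in> {y0<..<y1}" by auto
    moreover from this have "x0 < u z"
      using splitting_left_bounds(1)[of z] z by auto
    ultimately show "deriv sup_convolution z = deriv g1 (u z)"
      by (rule deriv_sup_convolution)
  qed
  have "filterlim (\<lambda>z. deriv g1 (u z)) at_bot (at_left y1)"
    by (rule filterlim_compose[OF left.deriv_at_bot filterlim_splitting_at_left])
  then show ?thesis
    using filterlim_cong[OF refl refl deriv_eq] by simp
qed

lemma triangle_function_sup_convolution: "triangle_function y0 y1 sup_convolution"
  unfolding triangle_function_def
proof (intro conjI ballI)
  show "sup_convolution differentiable (at z within {y0..y1})" if "z \<in> {y0..<y1}" for z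
  proof -
    obtain m where "m \<le> 0" "supergradient {y0..y1} sup_convolution z m"
      using ex_nonpos_supergradient[OF \<open>z \<in> {y0..<y1}\<close>] .
    then have "(sup_convolution has_real_derivative m) (at z within {y0..y1})"
      using that by (intro supergradient_imp_derivative) auto
    then show ?thesis
      unfolding real_differentiable_def ..
  qed
  show "(sup_convolution has_real_derivative 0) (at y0 within {y0..y1})"
    using supergradient_imp_derivative supergradient_zero_left sum_left_less_right by simp
qed (use sum_left_less_right strictly_concave_sup_convolution continuous_sup_convolution
    deriv_sup_convolution_at_bot in auto)

lemma subgraph_sup_convolution:
  "subgraph y0 y1 sup_convolution =
     {p + \<epsilon> *\<^sub>R q | p q. p \<in> subgraph x0 x1 g1 \<and> q \<in> subgraph x0' x1' g2}" (is "_ = ?sum")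
proof
  show "subgraph y0 y1 sup_convolution \<subseteq> ?sum"
  proof (rule subrelI)
    fix z y assume zy: "(z, y) \<in> subgraph y0 y1 sup_convolution"
    then have split: "u z \<in> {x0..x1}" "v z \<in> {x0'..x1'}" "u z + \<epsilon> * v z = z"
      using splitting[of z] by (auto simp: subgraph_def)
    have "(z, y) = (u z, g1 (u z)) + \<epsilon> *\<^sub>R (v z, (y - g1 (u z)) / \<epsilon>)"
      using split scale_pos by simp
    moreover have "(u z, g1 (u z)) \<in> subgraph x0 x1 g1"
      "(v z, (y - g1 (u z)) / \<epsilon>) \<in> subgraph x0' x1' g2"
      using split zy scale_pos
      by (auto simp: subgraph_def sup_convolution_def pos_divide_le_eq algebra_simps)
    ultimately show "(z, y) \<in> ?sum" by blast
  qed
  show "?sum \<subseteq> subgraph y0 y1 sup_convolution"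
  proof
    fix p assume "p \<in> ?sum"
    then obtain q r where p: "p = q + \<epsilon> *\<^sub>R r"
      and "q \<in> subgraph x0 x1 g1" "r \<in> subgraph x0' x1' g2"
      by blast
    then have mem: "fst q \<in> {x0..x1}" "fst r \<in> {x0'..x1'}"
      and "snd q \<le> g1 (fst q)" "\<epsilon> * snd r \<le> \<epsilon> * g2 (fst r)"
      using scale_pos by (auto simp: subgraph_def)
    then have "snd q + \<epsilon> * snd r \<le> sup_convolution (fst q + \<epsilon> * fst r)"
      using le_sup_convolution[OF mem] by linarith
    moreover have "p = (fst q + \<epsilon> * fst r, snd q + \<epsilon> * snd r)"
      by (simp add: p prod_eq_iff)
    ultimately show "p \<in> subgraph y0 y1 sup_convolution"
      using add_scaled_mem_Icc[OF mem scale_pos] by (simp add: subgraph_def)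
  qed
qed

end

lemma ex_optimal_splitting:
  assumes "triangle_function x0 x1 g1" "triangle_function x0' x1' g2" "\<epsilon> > 0"
  shows "\<exists>u v. optimal_splitting x0 x1 g1 x0' x1' g2 \<epsilon> u v"
proof -
  interpret left: triangle x0 x1 g1 by unfold_locales fact
  interpret right: triangle x0' x1' g2 by unfold_locales fact
  define K where "K z = ({x0..x1} \<times> {x0'..x1'}) \<inter> {(s, t). s + \<epsilon> * t = z}" for z
  let ?f = "\<lambda>(s, t). g1 s + \<epsilon> * g2 t"
  have "\<exists>p\<in>K z. \<forall>q\<in>K z. ?f q \<le> ?f p" if z: "z \<in> {x0 + \<epsilon> * x0'..x1 + \<epsilon> * x1'}" for z
  proof (rule continuous_attains_sup)
    have "closed {(s, t). s + \<epsilon> * t = z}"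
      unfolding case_prod_unfold by (intro closed_Collect_eq continuous_intros)
    then show "compact (K z)"
      unfolding K_def by (intro compact_Int_closed compact_Times) auto
    show "continuous_on (K z) ?f"
      unfolding case_prod_unfold K_def
      by (intro continuous_intros continuous_on_compose2[OF left.continuous]
          continuous_on_compose2[OF right.continuous]) auto
    show "K z \<noteq> {}"
      using ex_add_scaled_eq[OF z] left.left_less_right right.left_less_right \<open>\<epsilon> > 0\<close>
      by (fastforce simp: K_def)
  qed
  then obtain w where w: "\<And>z. z \<in> {x0 + \<epsilon> * x0'..x1 + \<epsilon> * x1'} \<Longrightarrow>
      w z \<in> K z \<and> (\<forall>q\<in>K z. ?f q \<le> ?f (w z))"
    by metis
  have "optimal_splitting x0 x1 g1 x0' x1' g2 \<epsilon> (\<lambda>z. fst (w z)) (\<lambda>z. snd (w z))"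
  proof
    show "fst (w z) \<in> {x0..x1} \<and> snd (w z) \<in> {x0'..x1'} \<and> fst (w z) + \<epsilon> * snd (w z) = z"
      if "z \<in> {x0 + \<epsilon> * x0'..x1 + \<epsilon> * x1'}" for z
      using w[OF that] by (auto simp: K_def)
    fix s t assume st: "s \<in> {x0..x1}" "t \<in> {x0'..x1'}"
    from w[OF add_scaled_mem_Icc[OF this \<open>\<epsilon> > 0\<close>]] st
    show "g1 s + \<epsilon> * g2 t \<le> g1 (fst (w (s + \<epsilon> * t))) + \<epsilon> * g2 (snd (w (s + \<epsilon> * t)))"
      by (force simp: K_def case_prod_unfold)
  qed fact
  then show ?thesis by blast
qed

lemma ex_triangle_sum:
  assumes "triangle_function x0 x1 g1" "triangle_function x0' x1' g2" "\<epsilon> > 0"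
  shows "\<exists>y0 y1 g. triangle_sum x0 x1 g1 x0' x1' g2 \<epsilon> y0 y1 g"
proof -
  obtain u v where "optimal_splitting x0 x1 g1 x0' x1' g2 \<epsilon> u v"
    using ex_optimal_splitting[OF assms] by blast
  then interpret optimal_splitting x0 x1 g1 x0' x1' g2 \<epsilon> u v .
  show ?thesis
    using triangle_function_sup_convolution subgraph_sup_convolution
    unfolding triangle_sum_def by blast
qed

section \<open>Lebesgue measure on the plane\<close>

lemma emeasure_lborel_slices:
  fixes A :: "('a::euclidean_space \<times> 'b::euclidean_space) set"
  assumes "A \<in> sets borel"
  shows "emeasure lborel A = (\<integral>\<^sup>+x. emeasure lborel (Pair x -` A) \<partial>lborel)"
proof -
  have "A \<in> sets (lborel \<Otimes>\<^sub>M lborel)"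
    unfolding lborel_prod sets_lborel by (rule assms)
  from lborel.emeasure_pair_measure_alt[OF this] show ?thesis
    unfolding lborel_prod .
qed

lemma lborel_distr_swap:
  "distr lborel borel prod.swap = (lborel :: ('a::euclidean_space \<times> 'b::euclidean_space) measure)"
proof -
  have "lborel = distr lborel lborel (\<lambda>(x :: 'b, y :: 'a). (y, x))"
    using lborel_pair.distr_pair_swap by (simp only: lborel_prod)
  also have "\<dots> = distr lborel borel prod.swap"
    by (intro distr_cong) auto
  finally show ?thesis ..
qed

lemma lborel_distr_shear_snd:
  fixes f :: "'a::euclidean_space \<Rightarrow> 'b::euclidean_space"
  assumes [measurable]: "f \<in> borel_measurable borel"
  shows "distr lborel borel (\<lambda>(x, y). (x, y + f x)) = lborel"
proof (rule measure_eqI)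
  fix A :: "('a \<times> 'b) set"
  assume "A \<in> sets (distr lborel borel (\<lambda>(x, y). (x, y + f x)))"
  then have A [measurable]: "A \<in> sets borel" by simp
  let ?h = "\<lambda>(x, y). (x, y + f x)"
  have h [measurable]: "?h \<in> borel \<rightarrow>\<^sub>M borel"
    unfolding borel_prod[symmetric] by measurable
  have "emeasure lborel (Pair x -` ?h -` A) = emeasure lborel (Pair x -` A)" for x
  proof -
    have slice: "Pair x -` A \<in> sets borel"
      using A by (intro measurable_sets_borel[OF borel_measurable_continuous_onI])
        (auto intro!: continuous_intros)
    have "Pair x -` ?h -` A = (+) (f x) -` (Pair x -` A)"
      by (auto simp: add.commute)
    then have "emeasure lborel (Pair x -` ?h -` A)
        = emeasure (distr lborel borel ((+) (f x))) (Pair x -` A)"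
      using slice by (simp add: emeasure_distr)
    then show ?thesis
      by (simp add: lborel_distr_plus)
  qed
  then have "emeasure lborel (?h -` A) = emeasure lborel A"
    using measurable_sets_borel[OF h A] by (simp add: emeasure_lborel_slices)
  then show "emeasure (distr lborel borel ?h) A = emeasure lborel A"
    by (simp add: emeasure_distr)
qed simp

lemma lborel_distr_comp:
  fixes S :: "'a::euclidean_space \<Rightarrow> 'b::euclidean_space" and T :: "'b \<Rightarrow> 'c::euclidean_space"
  assumes "distr lborel borel S = lborel" "distr lborel borel T = lborel"
    and "S \<in> borel_measurable borel" "T \<in> borel_measurable borel"
  shows "distr lborel borel (T \<circ> S) = lborel"
  using distr_distr[of T borel borel S lborel] assms by simp

lemma lborel_distr_shear_fst:
  fixes f :: "'b::euclidean_space \<Rightarrow> 'a::euclidean_space"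
  assumes f [measurable]: "f \<in> borel_measurable borel"
  shows "distr lborel borel (\<lambda>(x, y). (x + f y, y)) = lborel"
proof -
  have swap: "prod.swap \<in>
      borel_measurable (borel :: ('c::euclidean_space \<times> 'd::euclidean_space) measure)"
    unfolding prod.swap_def by (intro borel_measurable_continuous_onI continuous_intros)
  have shear: "(\<lambda>(x, y). (x, y + f x)) \<in> borel_measurable borel"
    unfolding borel_prod[symmetric] by measurable
  have "(\<lambda>(x, y). (x + f y, y)) = prod.swap \<circ> (\<lambda>(x, y). (x, y + f x)) \<circ> prod.swap"
    by auto
  moreover have "distr lborel borel (prod.swap \<circ> (\<lambda>(x, y). (x, y + f x)) \<circ> prod.swap) = lborel"
    by (intro lborel_distr_comp lborel_distr_swap lborel_distr_shear_snd
        measurable_comp[where N = borel] swap shear f)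
  ultimately show ?thesis by simp
qed

lemma lborel_distr_unimodular:
  fixes a b c d :: real
  assumes det: "a * d - b * c = 1"
  shows "distr lborel borel (\<lambda>(x, y). (a * x + b * y, c * x + d * y)) = lborel"
proof -
  define H V where "H k = (\<lambda>(x, y). (x + k * y, y))" and "V k = (\<lambda>(x, y). (x, y + k * x))"
    for k :: real
  have shears: "distr lborel borel (H k) = lborel" "distr lborel borel (V k) = lborel" for k
    using lborel_distr_shear_fst[of "\<lambda>y. k * y"] lborel_distr_shear_snd[of "\<lambda>x. k * x"]
    by (simp_all add: H_def V_def)
  have measurable: "H k \<in> borel_measurable borel" "V k \<in> borel_measurable borel" for k
    unfolding H_def V_def case_prod_unfold
    by (intro borel_measurable_continuous_onI continuous_intros)+
  show ?thesis
  proof (cases "c = 0")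
    case False
    define p q where "p = (a - 1) / c" and "q = (d - 1) / c"
    have entries: "a = 1 + p * c" "d = 1 + c * q" "b = q + p * d"
      using det False by (simp_all add: p_def q_def field_simps)
    have "(\<lambda>(x, y). (a * x + b * y, c * x + d * y)) = H p \<circ> V c \<circ> H q"
      by (auto simp: H_def V_def fun_eq_iff entries algebra_simps)
    moreover have "distr lborel borel (H p \<circ> V c \<circ> H q) = lborel"
      by (intro lborel_distr_comp measurable_comp[where N = borel] shears measurable)
    ultimately show ?thesis by simp
  next
    case True
    with det have "a * d = 1" by simp
    then have "a \<noteq> 0" by auto
    with \<open>a * d = 1\<close> have d: "d = 1 / a"
      by (simp add: eq_divide_eq mult.commute)
    \<comment> \<open>A vertical shear first makes the lower left entry nonzero; \<open>V (- 1)\<close> undoes it.\<close>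
    define p q where "p = (a - 1) / a" and "q = (b + d - 1) / a"
    have "(\<lambda>(x, y). (a * x + b * y, c * x + d * y)) = V (- 1) \<circ> H p \<circ> V a \<circ> H q"
      using \<open>a \<noteq> 0\<close> by (auto simp: H_def V_def p_def q_def fun_eq_iff d True field_simps)
    moreover have "distr lborel borel (V (- 1) \<circ> H p \<circ> V a \<circ> H q) = lborel"
      by (intro lborel_distr_comp measurable_comp[where N = borel] shears measurable)
    ultimately show ?thesis by simp
  qed
qed

lemma right_triangle_borel:
  "{(x, y). x \<le> \<alpha> \<and> y \<le> \<beta> \<and> \<kappa> < x + y} \<in> sets (borel :: (real \<times> real) measure)"
proof -
  have "{(x, y). x \<le> \<alpha> \<and> y \<le> \<beta> \<and> \<kappa> < x + y} = ({..\<alpha>} \<times> {..\<beta>}) \<inter> {p. \<kappa> < fst p + snd p}"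
    by auto
  also have "\<dots> \<in> sets borel"
    by (intro sets.Int[OF borel_closed borel_open] closed_Times open_Collect_less continuous_intros)
  finally show ?thesis .
qed

lemma emeasure_lborel_right_triangle:
  fixes \<alpha> \<beta> \<kappa> :: real
  assumes "\<kappa> \<le> \<alpha> + \<beta>"
  shows "emeasure lborel {(x, y). x \<le> \<alpha> \<and> y \<le> \<beta> \<and> \<kappa> < x + y} = ennreal ((\<alpha> + \<beta> - \<kappa>)\<^sup>2 / 2)"
proof -
  let ?T = "{(x, y). x \<le> \<alpha> \<and> y \<le> \<beta> \<and> \<kappa> < x + y}"
  have "emeasure lborel ?T = (\<integral>\<^sup>+x. emeasure lborel (Pair x -` ?T) \<partial>lborel)"
    by (rule emeasure_lborel_slices[OF right_triangle_borel])
  also have "\<dots> = (\<integral>\<^sup>+x. ennreal (x + \<beta> - \<kappa>) * indicator {\<kappa> - \<beta>..\<alpha>} x \<partial>lborel)"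
  proof (intro nn_integral_cong)
    fix x
    have "Pair x -` ?T = (if x \<le> \<alpha> then {\<kappa> - x<..\<beta>} else {})" by auto
    then show "emeasure lborel (Pair x -` ?T) = ennreal (x + \<beta> - \<kappa>) * indicator {\<kappa> - \<beta>..\<alpha>} x"
      by (cases "\<kappa> - \<beta> \<le> x") (auto simp: indicator_def algebra_simps)
  qed
  also have "\<dots> = ennreal ((\<alpha> + \<beta> - \<kappa>)\<^sup>2 / 2 - (\<kappa> - \<beta> + \<beta> - \<kappa>)\<^sup>2 / 2)"
    using assms by (intro nn_integral_FTC_Icc) (auto intro!: derivative_eq_intros)
  finally show ?thesis by simp
qed

lemma has_sum_measure_UN:
  assumes "countable I" and "\<And>i. i \<in> I \<Longrightarrow> A i \<in> sets M" and "disjoint_family_on A I"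
    and fin: "emeasure M (\<Union>i\<in>I. A i) \<noteq> \<infinity>"
  shows "((\<lambda>i. measure M (A i)) has_sum measure M (\<Union>i\<in>I. A i)) I"
proof -
  have UN: "(\<Union>i\<in>I. A i) \<in> sets M"
    using assms by (intro sets.countable_UN') auto
  have "emeasure M (A i) \<noteq> \<infinity>" if "i \<in> I" for i
    using fin emeasure_mono[OF UN_upper UN, OF that] by (auto simp: top_unique)
  then have "(\<integral>\<^sup>+i. ennreal (measure M (A i)) \<partial>count_space I) =
      (\<integral>\<^sup>+i. emeasure M (A i) \<partial>count_space I)"
    by (intro nn_integral_cong) (auto simp: emeasure_eq_ennreal_measure)
  also have "\<dots> = emeasure M (\<Union>i\<in>I. A i)"
    using assms by (intro emeasure_UN_countable[symmetric]) auto
  also have "\<dots> = ennreal (measure M (\<Union>i\<in>I. A i))"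
    using fin by (simp add: emeasure_eq_ennreal_measure)
  finally have "has_bochner_integral (count_space I) (\<lambda>i. measure M (A i)) (measure M (\<Union>i\<in>I. A i))"
    by (intro has_bochner_integral_nn_integral) auto
  then have "Infinite_Set_Sum.abs_summable_on (\<lambda>i. measure M (A i)) I"
    and "infsetsum (\<lambda>i. measure M (A i)) I = measure M (\<Union>i\<in>I. A i)"
    by (simp_all add: abs_summable_on_def infsetsum_def has_bochner_integral_iff)
  then show ?thesis
    by (metis abs_summable_equivalent abs_summable_summable has_sum_infsum infsetsum_infsum)
qed

section \<open>Sublinear functions on the lattice quadrant\<close>

definition unimodular_rows :: "(nat \<times> nat \<times> nat \<times> nat) set" where
  "unimodular_rows = {(a, b, c, d). int a * int d - int b * int c = 1}"

lemma mem_unimodular_rows: "(a, b, c, d) \<in> unimodular_rows \<longleftrightarrow> a * d = b * c + 1"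
proof -
  have "int a * int d - int b * int c = 1 \<longleftrightarrow> int (a * d) = int (b * c + 1)" by auto
  then show ?thesis
    unfolding unimodular_rows_def by (simp only: mem_Collect_eq case_prod_conv of_nat_eq_iff)
qed

lemma unimodular_rows_coprime:
  assumes "(a, b, c, d) \<in> unimodular_rows"
  shows "coprime a b" "coprime c d" "coprime (a + c) (b + d)"
proof -
  have det: "int a * int d - int b * int c = 1"
    using assms by (simp add: unimodular_rows_def)
  have "coprime p q" if "int p * i + int q * j = 1" for p q i j
    using that by (metis coprime_int_iff coprimeI dvd_add dvd_mult2)
  note this[of a d b "- c"] this[of c "- b" d a] this[of "a + c" d "b + d" "- c"]
  then show "coprime a b" "coprime c d" "coprime (a + c) (b + d)"
    using det by (simp_all add: algebra_simps)
qed

lemma unimodular_coordinates: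
  fixes a b c d p q :: nat
  assumes "(a, b, c, d) \<in> unimodular_rows"
  shows "int p = (int p * int d - int q * int c) * int a + (int a * int q - int b * int p) * int c"
    and "int q = (int p * int d - int q * int c) * int b + (int a * int q - int b * int p) * int d"
proof -
  have "int a * int d = int b * int c + 1"
    using assms by (simp add: unimodular_rows_def)
  then show "int p = (int p * int d - int q * int c) * int a + (int a * int q - int b * int p) * int c"
    "int q = (int p * int d - int q * int c) * int b + (int a * int q - int b * int p) * int d"
    by algebra+
qed

lemma unimodular_rows_eq_if_mediant_eq:
  assumes s: "(a, b, c, d) \<in> unimodular_rows" and s': "(a', b', c', d') \<in> unimodular_rows"
    and mediant: "a + c = a' + c'" "b + d = b' + d'"
  shows "(a, b, c, d) = (a', b', c', d')"
proof -
  define p q where "p = int (a + c)" and "q = int (b + d)"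
  have "int a * q - int b * p = 1"
    using s by (simp add: unimodular_rows_def p_def q_def algebra_simps)
  moreover have "int a' * q - int b' * p = 1"
    using s' by (simp add: unimodular_rows_def p_def q_def mediant algebra_simps)
  ultimately have diff: "(int a - int a') * q = (int b - int b') * p"
    by (simp add: algebra_simps)
  have "coprime p q"
    using unimodular_rows_coprime(3)[OF s] by (simp add: p_def q_def flip: coprime_int_iff)
  moreover have "p dvd (int a - int a') * q"
    unfolding diff by simp
  ultimately have "p dvd int a - int a'"
    by (simp add: coprime_dvd_mult_left_iff)
  moreover have "0 < a" "0 < a'"
    using s s' by (auto simp: mem_unimodular_rows intro: gr0I)
  then have "\<bar>int a - int a'\<bar> < p"
    using mediant by (simp add: p_def)
  ultimately have "a = a'"
    using dvd_imp_le_int[of "int a - int a'" p] by auto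
  moreover from this have "b = b'"
    using diff \<open>0 < a\<close> by (simp add: p_def)
  ultimately show ?thesis
    using mediant by simp
qed

definition sign_change :: "(nat \<Rightarrow> nat \<Rightarrow> real) \<Rightarrow> (nat \<times> nat \<times> nat \<times> nat) set" where
  "sign_change \<phi> =
     {(a, b, c, d) \<in> unimodular_rows. 0 \<le> \<phi> a b \<and> 0 \<le> \<phi> c d \<and> \<phi> (a + c) (b + d) < 0}"

locale sublinear =
  fixes \<phi> :: "nat \<Rightarrow> nat \<Rightarrow> real"
  assumes homogeneous: "\<And>k a b. \<phi> (k * a) (k * b) = real k * \<phi> a b"
    and subadditive: "\<And>a b c d. \<phi> (a + c) (b + d) \<le> \<phi> a b + \<phi> c d"
begin

lemma ex_sign_change_from:
  assumes "(a, b, c, d) \<in> unimodular_rows" "0 \<le> \<phi> a b" "0 \<le> \<phi> c d"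
    and "\<phi> (m * a + n * c) (m * b + n * d) < 0"
  shows "\<exists>s. s \<in> sign_change \<phi>"
  using assms
proof (induction "m + n" arbitrary: a b c d m n rule: less_induct)
  case less
  have "0 \<le> \<phi> (n * c) (n * d)" "0 \<le> \<phi> (m * a) (m * b)"
    using less.prems by (simp_all add: homogeneous)
  then have pos: "m > 0" "n > 0"
    using less.prems(4) by (auto intro!: gr0I)
  show ?case
  proof (cases "\<phi> (a + c) (b + d) < 0")
    case True
    then have "(a, b, c, d) \<in> sign_change \<phi>"
      using less.prems by (simp add: sign_change_def)
    then show ?thesis ..
  next
    case False
    consider (more_left) k where "m = n + k" | (more_right) k where "n = m + k"
      using nat_le_linear le_Suc_ex by metis
    then show ?thesis
    proof cases
      case more_left
      then show ?thesis
        using less.prems False pos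
        by (intro less.hyps[of k n a b "a + c" "b + d"])
          (auto simp: mem_unimodular_rows algebra_simps)
    next
      case more_right
      then show ?thesis
        using less.prems False pos
        by (intro less.hyps[of m k "a + c" "b + d" c d])
          (auto simp: mem_unimodular_rows algebra_simps)
    qed
  qed
qed

lemma ex_sign_change:
  assumes "0 \<le> \<phi> 1 0" "0 \<le> \<phi> 0 1" "\<phi> p q < 0"
  shows "\<exists>s. s \<in> sign_change \<phi>"
  using assms by (intro ex_sign_change_from[of 1 0 0 1 p q]) (auto simp: mem_unimodular_rows)

lemma multiple_ne_negative_combination:
  assumes "0 \<le> \<phi> a b" "\<phi> r s < 0" "\<phi> p q < 0" "p + k * r = j * a"
  shows "q + k * s \<noteq> j * b"
proof
  assume "q + k * s = j * b"
  then have "real j * \<phi> a b \<le> \<phi> p q + real k * \<phi> r s"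
    using subadditive[of p "k * r" q "k * s"] assms by (simp add: homogeneous)
  moreover have "real k * \<phi> r s \<le> 0"
    using assms by (simp add: mult_nonneg_nonpos)
  ultimately show False
    using assms by (smt (verit) mult_nonneg_nonneg of_nat_0_le_iff)
qed

text \<open>If \<open>(p, q)\<close> did not lie beyond \<open>(a, b)\<close>, adding a multiple of the mediant would move it onto
  the ray of \<open>(a, b)\<close>, although \<open>\<phi>\<close> is negative at \<open>(p, q)\<close> and at the mediant.\<close>

lemma sign_change_slope_left_less:
  assumes s: "(a, b, c, d) \<in> sign_change \<phi>" and neg: "\<phi> p q < 0"
  shows "b * p < a * q"
proof (rule ccontr)
  assume "\<not> b * p < a * q"
  define m n where "m = int p * int d - int q * int c" and "n = int a * int q - int b * int p"
  have "n \<le> 0"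
    using \<open>\<not> b * p < a * q\<close> by (simp add: n_def not_less flip: of_nat_mult)
  have rows: "(a, b, c, d) \<in> unimodular_rows" and "0 \<le> \<phi> a b"
    and mediant: "\<phi> (a + c) (b + d) < 0"
    using s by (auto simp: sign_change_def)
  have pq: "int p = m * int a + n * int c" "int q = m * int b + n * int d"
    using unimodular_coordinates[OF rows] by (simp_all add: m_def n_def)
  have "0 < a"
    using rows by (auto simp: mem_unimodular_rows intro: gr0I)
  have "0 \<le> int p - n * int c"
    using mult_nonpos_nonneg[OF \<open>n \<le> 0\<close>, of "int c"] by simp
  also have "\<dots> = m * int a"
    by (simp add: pq)
  finally have "0 \<le> m"
    using \<open>0 < a\<close> by (simp add: zero_le_mult_iff)
  obtain k where k: "- n = int k"
    using \<open>n \<le> 0\<close> by (metis neg_0_le_iff_le nonneg_int_cases)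
  obtain j where j: "m - n = int j"
    using \<open>n \<le> 0\<close> \<open>0 \<le> m\<close> by (metis diff_ge_0_iff_ge nonneg_int_cases order_trans)
  have "int p + int k * (int a + int c) = int j * int a"
    "int q + int k * (int b + int d) = int j * int b"
    unfolding pq k[symmetric] j[symmetric] by (simp_all add: algebra_simps)
  then have "p + k * (a + c) = j * a" "q + k * (b + d) = j * b"
    by (simp_all flip: of_nat_add of_nat_mult)
  then show False
    using multiple_ne_negative_combination[OF \<open>0 \<le> \<phi> a b\<close> mediant neg] by blast
qed

lemma sublinear_swap: "sublinear (\<lambda>a b. \<phi> b a)"
  using homogeneous subadditive by unfold_locales

lemma sign_change_slope_less_right:
  assumes s: "(a, b, c, d) \<in> sign_change \<phi>" and neg: "\<phi> p q < 0"
  shows "q * c < p * d"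
proof -
  have "(d, c, b, a) \<in> sign_change (\<lambda>a b. \<phi> b a)"
    using s by (auto simp: sign_change_def mem_unimodular_rows add.commute mult.commute)
  from sublinear.sign_change_slope_left_less[OF sublinear_swap this neg] show ?thesis
    by (simp add: mult.commute)
qed

lemma sign_change_mediant_le:
  assumes s: "(a, b, c, d) \<in> sign_change \<phi>" and neg: "\<phi> p q < 0"
  shows "a + c \<le> p" "b + d \<le> q"
proof -
  define m n where "m = int p * int d - int q * int c" and "n = int a * int q - int b * int p"
  have "int (q * c) < int (p * d)" "int (b * p) < int (a * q)"
    using sign_change_slope_left_less[OF s neg] sign_change_slope_less_right[OF s neg]
    by (simp_all only: of_nat_less_iff)
  then have "1 \<le> m" "1 \<le> n"
    by (simp_all add: m_def n_def)
  then have "1 * int a + 1 * int c \<le> m * int a + n * int c"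
    "1 * int b + 1 * int d \<le> m * int b + n * int d"
    by (intro add_mono mult_right_mono; simp)+
  moreover have "(a, b, c, d) \<in> unimodular_rows"
    using s by (simp add: sign_change_def)
  ultimately show "a + c \<le> p" "b + d \<le> q"
    using unimodular_coordinates[of a b c d, where p = p and q = q] by (simp_all add: m_def n_def)
qed

lemma sign_change_unique:
  assumes "s \<in> sign_change \<phi>" "t \<in> sign_change \<phi>"
  shows "s = t"
proof -
  obtain a b c d a' b' c' d' where s: "s = (a, b, c, d)" and t: "t = (a', b', c', d')"
    by (metis prod_cases4)
  have "\<phi> (a + c) (b + d) < 0" "\<phi> (a' + c') (b' + d') < 0"
    using assms by (auto simp: s t sign_change_def)
  then have "a + c = a' + c'" "b + d = b' + d'"
    using sign_change_mediant_le assms unfolding s t by (meson order_antisym)+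
  then show ?thesis
    using assms unfolding s t
    by (intro unimodular_rows_eq_if_mediant_eq) (auto simp: sign_change_def)
qed

end

section \<open>Dissection of a triangle into corner triangles\<close>

definition defect :: "(nat \<Rightarrow> nat \<Rightarrow> real) \<Rightarrow> nat \<times> nat \<times> nat \<times> nat \<Rightarrow> real" where
  "defect \<gamma> = (\<lambda>(a, b, c, d). \<gamma> a b + \<gamma> c d - \<gamma> (a + c) (b + d))"

definition corner_triangle ::
    "(nat \<Rightarrow> nat \<Rightarrow> real) \<Rightarrow> nat \<times> nat \<times> nat \<times> nat \<Rightarrow> (real \<times> real) set" where
  "corner_triangle \<gamma> = (\<lambda>(a, b, c, d).
     {(x, y). real a * x + real b * y \<le> \<gamma> a b \<and> real c * x + real d * y \<le> \<gamma> c d \<and>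
        \<gamma> (a + c) (b + d) < real (a + c) * x + real (b + d) * y})"

lemma
  assumes s: "s \<in> unimodular_rows"
  shows corner_triangle_borel: "corner_triangle \<gamma> s \<in> sets borel"
    and measure_corner_triangle:
      "0 \<le> defect \<gamma> s \<Longrightarrow> measure lborel (corner_triangle \<gamma> s) = (defect \<gamma> s)\<^sup>2 / 2"
proof -
  obtain a b c d where s_eq: "s = (a, b, c, d)" by (cases s)
  let ?f = "\<lambda>(x, y). (real a * x + real b * y, real c * x + real d * y)"
  let ?T = "{(x, y). x \<le> \<gamma> a b \<and> y \<le> \<gamma> c d \<and> \<gamma> (a + c) (b + d) < x + y}"
  have f: "?f \<in> borel_measurable borel"
    unfolding case_prod_unfold by (intro borel_measurable_continuous_onI continuous_intros)
  have vimage: "corner_triangle \<gamma> s = ?f -` ?T"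
    by (auto simp: s_eq corner_triangle_def algebra_simps)
  show "corner_triangle \<gamma> s \<in> sets borel"
    unfolding vimage by (rule measurable_sets_borel[OF f right_triangle_borel])
  have "real (a * d) = real (b * c + 1)"
    using s by (simp only: s_eq mem_unimodular_rows)
  then have "distr lborel borel ?f = lborel"
    by (intro lborel_distr_unimodular) simp
  then have "measure lborel (corner_triangle \<gamma> s) = measure lborel ?T"
    using measure_distr[of ?f lborel borel ?T] f right_triangle_borel by (simp add: vimage)
  then show "measure lborel (corner_triangle \<gamma> s) = (defect \<gamma> s)\<^sup>2 / 2" if "0 \<le> defect \<gamma> s"
    using that by (simp add: s_eq defect_def emeasure_lborel_right_triangle measure_def)
qed

lemma supporting_line_unique:
  assumes "supporting_line x0 x1 g a b \<gamma>" "supporting_line x0 x1 g a b \<gamma>'"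
  shows "\<gamma> = \<gamma>'"
  using assms unfolding supporting_line_def by (metis order_antisym)

lemma ex_nat_quotient_between:
  fixes l r :: real
  assumes "0 \<le> l" "l < r"
  shows "\<exists>a b :: nat. 0 < b \<and> l < real a / real b \<and> real a / real b < r"
proof -
  obtain t where t: "t \<in> \<rat>" "l < t" "t < r"
    using Rats_dense_in_real[OF \<open>l < r\<close>] by auto
  obtain a b :: nat where "b \<noteq> 0" "\<bar>t\<bar> = real a / real b"
    using Rats_abs_nat_div_natE[OF t(1)] by metis
  with t \<open>0 \<le> l\<close> show ?thesis
    by (intro exI[of _ a] exI[of _ b]) auto
qed

context triangle
begin

definition support :: "nat \<Rightarrow> nat \<Rightarrow> real" where
  "support a b = (SUP x\<in>{x0..x1}. real a * x + real b * g x)"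

lemma supporting_line_iff: "supporting_line x0 x1 g a b \<gamma> \<longleftrightarrow> \<gamma> = support a b"
proof -
  let ?f = "\<lambda>x. real a * x + real b * g x"
  have "\<exists>x\<in>{x0..x1}. \<forall>y\<in>{x0..x1}. ?f y \<le> ?f x"
    using left_less_right
    by (intro continuous_attains_sup compact_Icc continuous_intros continuous) auto
  then obtain x where x: "x \<in> {x0..x1}" "\<And>y. y \<in> {x0..x1} \<Longrightarrow> ?f y \<le> ?f x"
    by blast
  then have "support a b = ?f x"
    unfolding support_def by (intro cSup_eq_maximum) auto
  with x have "supporting_line x0 x1 g a b (support a b)"
    unfolding supporting_line_def by auto
  then show ?thesis
    using supporting_line_unique by blast
qed

lemma le_support: "x \<in> {x0..x1} \<Longrightarrow> real a * x + real b * g x \<le> support a b"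
  and support_attained: "\<exists>x\<in>{x0..x1}. real a * x + real b * g x = support a b"
  using supporting_line_iff[of a b "support a b"] by (auto simp: supporting_line_def)

lemma support_1_0: "support 1 0 = x1"
  using supporting_line_iff[of 1 0 x1] left_less_right by (auto simp: supporting_line_def)

lemma support_0_1: "support 0 1 = g x0"
  using supporting_line_iff[of 0 1 "g x0"] left_less_right le_left
  by (force simp: supporting_line_def)

lemma support_homogeneous: "support (k * a) (k * b) = real k * support a b"
proof -
  have "supporting_line x0 x1 g (k * a) (k * b) (real k * support a b)"
    unfolding supporting_line_def
  proof
    have scale: "real (k * a) * x + real (k * b) * g x = real k * (real a * x + real b * g x)" for x
      by (simp add: algebra_simps)
    show "\<forall>x\<in>{x0..x1}. real (k * a) * x + real (k * b) * g x \<le> real k * support a b"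
      unfolding scale by (simp add: le_support mult_left_mono)
    show "\<exists>x\<in>{x0..x1}. real (k * a) * x + real (k * b) * g x = real k * support a b"
      unfolding scale using support_attained[of a b] by auto
  qed
  then show ?thesis
    by (simp add: supporting_line_iff)
qed

lemma support_subadditive: "support (a + c) (b + d) \<le> support a b + support c d"
proof -
  obtain x where "x \<in> {x0..x1}" "real (a + c) * x + real (b + d) * g x = support (a + c) (b + d)"
    using support_attained by blast
  with le_support[of x a b] le_support[of x c d] show ?thesis
    by (simp add: algebra_simps)
qed

definition slack :: "real \<Rightarrow> real \<Rightarrow> nat \<Rightarrow> nat \<Rightarrow> real" where
  "slack x y a b = support a b - (real a * x + real b * y)"

lemma sublinear_slack: "sublinear (slack x y)"
proof
  show "slack x y (k * a) (k * b) = real k * slack x y a b" for k a b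
    using support_homogeneous[of k a b] by (simp add: slack_def algebra_simps)
  show "slack x y (a + c) (b + d) \<le> slack x y a b + slack x y c d" for a b c d
    using support_subadditive[of a c b d] by (simp add: slack_def algebra_simps)
qed

lemma slack_1_0: "slack x y 1 0 = x1 - x"
  and slack_0_1: "slack x y 0 1 = g x0 - y"
  using support_1_0 support_0_1 by (simp_all add: slack_def)

lemma slack_nonneg:
  assumes "u \<in> {x0..x1}" "x \<le> u" "y \<le> g u"
  shows "0 \<le> slack x y a b"
proof -
  have "real a * x + real b * y \<le> real a * u + real b * g u"
    using assms by (intro add_mono mult_left_mono) auto
  also have "\<dots> \<le> support a b"
    by (rule le_support[OF assms(1)])
  finally show ?thesis
    by (simp add: slack_def)
qed

lemma defect_support_nonneg: "0 \<le> defect support s"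
  by (cases s) (simp add: defect_def support_subadditive)

lemma mem_corner_triangle_iff:
  assumes "s \<in> unimodular_rows"
  shows "(x, y) \<in> corner_triangle support s \<longleftrightarrow> s \<in> sign_change (slack x y)"
  using assms by (cases s) (auto simp: corner_triangle_def sign_change_def slack_def)

lemma disjoint_corner_triangles: "disjoint_family_on (corner_triangle support) unimodular_rows"
  unfolding disjoint_family_on_def
  by (auto simp: mem_corner_triangle_iff dest: sublinear.sign_change_unique[OF sublinear_slack])

lemma corner_triangle_subset:
  assumes s: "s \<in> unimodular_rows"
  shows "corner_triangle support s \<subseteq> g_triangle x0 x1 g"
proof (rule subrelI)
  fix x y assume "(x, y) \<in> corner_triangle support s"
  then have "s \<in> sign_change (slack x y)"
    using s by (simp add: mem_corner_triangle_iff)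
  moreover obtain a b c d where s_eq: "s = (a, b, c, d)" by (cases s)
  ultimately have abcd: "(a, b, c, d) \<in> sign_change (slack x y)" by simp
  then have mediant: "slack x y (a + c) (b + d) < 0" and pos: "0 < a + c" "0 < b + d"
    by (auto simp: sign_change_def mem_unimodular_rows intro!: gr0I)
  note le = sublinear.sign_change_mediant_le[OF sublinear_slack abcd]
  have "x \<le> x1"
    using le(2)[of 1 0, unfolded slack_1_0] pos by (cases "x \<le> x1") auto
  moreover have "y \<le> g x0"
    using le(1)[of 0 1, unfolded slack_0_1] pos by (cases "y \<le> g x0") auto
  moreover from this have "x0 \<le> x"
    using slack_nonneg[of x0 x y "a + c" "b + d"] mediant left_less_right by (cases "x0 \<le> x") auto
  moreover from this have "g x \<le> y"
    using slack_nonneg[of x x y "a + c" "b + d"] mediant \<open>x \<le> x1\<close> by (cases "g x \<le> y") auto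
  ultimately show "(x, y) \<in> g_triangle x0 x1 g"
    by (simp add: g_triangle_def)
qed

text \<open>A rational slope slightly steeper than the tangent at \<open>x\<close> still separates \<open>(x, y)\<close> from the
  graph.\<close>

lemma ex_slack_negative:
  assumes x: "x \<in> {x0<..<x1}" and y: "g x < y"
  shows "\<exists>a b. slack x y a b < 0"
proof -
  obtain m where m: "supergradient {x0..x1} g x m"
    using concave_on_ex_supergradient[OF concave] x by auto
  have "m < 0"
    using supergradient_nonneg_imp_left[OF m] x by fastforce
  define \<eta> where "\<eta> = (y - g x) / (x1 - x)"
  have "\<eta> > 0"
    using x y by (simp add: \<eta>_def)
  with \<open>m < 0\<close> obtain a b :: nat where "0 < b" "- m < real a / real b" "real a / real b < - m + \<eta>"
    using ex_nat_quotient_between[of "- m" "- m + \<eta>"] by auto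
  moreover define t where "t = real a / real b"
  ultimately have t: "- m < t" "t < - m + \<eta>" and a: "real a = t * real b" and "0 < real b"
    by simp_all
  obtain z where z: "z \<in> {x0..x1}" "real a * z + real b * g z = support a b"
    using support_attained by blast
  have "t * z + g z \<le> t * x + g x + (t + m) * (z - x)"
    using supergradientD[OF m z(1)] by (simp add: algebra_simps)
  also have "(t + m) * (z - x) \<le> (t + m) * (x1 - x)"
    using t z by (intro mult_left_mono) auto
  also have "(t + m) * (x1 - x) < \<eta> * (x1 - x)"
    using t x by (intro mult_strict_right_mono) auto
  also have "\<eta> * (x1 - x) = y - g x"
    using x by (simp add: \<eta>_def)
  finally have "t * z + g z < t * x + y" by simp
  then have "real b * (t * z + g z) < real b * (t * x + y)"
    using \<open>0 < real b\<close> by simp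
  then have "slack x y a b < 0"
    unfolding slack_def z(2)[symmetric] a by (simp add: algebra_simps)
  then show ?thesis by blast
qed

lemma corner_triangles_cover:
  assumes xy: "(x, y) \<in> g_triangle x0 x1 g" "x \<noteq> x1" "y \<noteq> g x"
  shows "(x, y) \<in> (\<Union>s\<in>unimodular_rows. corner_triangle support s)"
proof -
  have "x \<noteq> x0"
    using xy by (auto simp: g_triangle_def)
  then have x: "x \<in> {x0<..<x1}" and y: "g x < y" "y \<le> g x0"
    using xy by (auto simp: g_triangle_def)
  obtain p q where neg: "slack x y p q < 0"
    using ex_slack_negative[OF x y(1)] by blast
  then obtain s where s: "s \<in> sign_change (slack x y)"
    using sublinear.ex_sign_change[OF sublinear_slack _ _ neg, unfolded slack_1_0 slack_0_1] x y
    by auto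
  moreover from this have "s \<in> unimodular_rows"
    by (auto simp: sign_change_def)
  ultimately show ?thesis
    using mem_corner_triangle_iff by blast
qed

lemma compact_g_triangle: "compact (g_triangle x0 x1 g)"
proof -
  obtain z where minimum: "\<And>x. x \<in> {x0..x1} \<Longrightarrow> g z \<le> g x"
    using continuous_attains_inf[OF compact_Icc _ continuous] left_less_right by force
  define R where "R = {x0..x1} \<times> {g z..g x0}"
  have "compact R"
    unfolding R_def by (intro compact_Times compact_Icc)
  moreover have "closed {p \<in> R. g (fst p) \<le> snd p}"
    using \<open>compact R\<close> unfolding R_def
    by (intro continuous_on_closed_Collect_le continuous_on_compose2[OF continuous] continuous_intros)
      (auto intro: compact_imp_closed)
  moreover have "g_triangle x0 x1 g = R \<inter> {p \<in> R. g (fst p) \<le> snd p}"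
  proof -
    have "g z \<le> y" if "g x \<le> y" "x \<in> {x0..x1}" for x y
      using minimum[OF that(2)] that(1) by linarith
    then show ?thesis
      by (auto simp: g_triangle_def R_def)
  qed
  ultimately show ?thesis
    by (simp add: compact_Int_closed)
qed

lemma AE_corner_triangles_cover:
  "AE p in lborel. p \<in> g_triangle x0 x1 g \<longleftrightarrow> p \<in> (\<Union>s\<in>unimodular_rows. corner_triangle support s)"
  (is "AE p in lborel. p \<in> ?G \<longleftrightarrow> p \<in> ?V")
proof -
  have "?G \<in> sets borel" "?V \<in> sets borel"
    using compact_g_triangle corner_triangle_borel by (auto intro: borel_compact)
  moreover have "{p. p \<in> ?G \<longrightarrow> p \<in> ?V} = - ?G \<union> ?V"
    by auto
  ultimately have "{p. p \<in> ?G \<longrightarrow> p \<in> ?V} \<in> sets borel"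
    by simp
  then have "AE p in lborel \<Otimes>\<^sub>M lborel. p \<in> ?G \<longrightarrow> p \<in> ?V"
  proof (intro lborel_pair.AE_pair_measure)
    show "AE x in lborel. AE y in lborel. (x, y) \<in> ?G \<longrightarrow> (x, y) \<in> ?V"
      using AE_lborel_singleton[of x1]
    proof eventually_elim
      case (elim x)
      show ?case
        using AE_lborel_singleton[of "g x"]
        by eventually_elim (use elim corner_triangles_cover in auto)
    qed
  qed (unfold lborel_prod, simp)
  then show ?thesis
    unfolding lborel_prod by (rule eventually_mono) (use corner_triangle_subset in blast)
qed

lemma has_sum_defect_square_support:
  "((\<lambda>s. (defect support s)\<^sup>2) has_sum 2 * measure lborel (g_triangle x0 x1 g)) unimodular_rows"
proof -
  let ?V = "\<Union>s\<in>unimodular_rows. corner_triangle support s"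
  let ?area = "measure lborel (g_triangle x0 x1 g)"
  have sets: "g_triangle x0 x1 g \<in> sets lborel" "?V \<in> sets lborel"
    using compact_g_triangle corner_triangle_borel by (auto intro: borel_compact)
  have "emeasure lborel ?V \<le> emeasure lborel (g_triangle x0 x1 g)"
    using sets by (intro emeasure_mono UN_least corner_triangle_subset)
  then have "emeasure lborel ?V \<noteq> \<infinity>"
    using emeasure_compact_finite[OF compact_g_triangle] by (auto simp: top_unique)
  then have "((\<lambda>s. measure lborel (corner_triangle support s)) has_sum measure lborel ?V)
      unimodular_rows"
    using corner_triangle_borel disjoint_corner_triangles by (intro has_sum_measure_UN) auto
  also have "measure lborel ?V = ?area"
    using AE_corner_triangles_cover sets by (intro measure_eq_AE) auto
  also have "((\<lambda>s. measure lborel (corner_triangle support s)) has_sum ?area) unimodular_rows \<longleftrightarrow>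
      ((\<lambda>s. (defect support s)\<^sup>2 / 2) has_sum ?area) unimodular_rows"
    using defect_support_nonneg by (intro has_sum_cong measure_corner_triangle)
  finally have "((\<lambda>s. (defect support s)\<^sup>2 / 2) has_sum ?area) unimodular_rows" .
  from has_sum_cmult_right[OF this, of 2] show ?thesis by simp
qed

end

section \<open>The mixed area\<close>

lemma has_sum_defect_square:
  assumes "triangle_function x0 x1 g"
    and coeff: "\<And>a b. coprime a b \<Longrightarrow> supporting_line x0 x1 g a b (\<gamma> a b)"
  shows "((\<lambda>s. (defect \<gamma> s)\<^sup>2) has_sum 2 * measure lborel (g_triangle x0 x1 g)) unimodular_rows"
proof -
  interpret triangle x0 x1 g by unfold_locales fact
  have "\<gamma> a b = support a b" if "coprime a b" for a b
    using coeff[OF that] by (simp add: supporting_line_iff)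
  then have "defect \<gamma> (a, b, c, d) = defect support (a, b, c, d)"
    if "(a, b, c, d) \<in> unimodular_rows" for a b c d
    using unimodular_rows_coprime[OF that] by (simp add: defect_def)
  then have "defect \<gamma> s = defect support s" if "s \<in> unimodular_rows" for s
    using that by (cases s) simp
  with has_sum_defect_square_support show ?thesis
    by (simp cong: has_sum_cong)
qed

lemma has_sum_defect_square_triangle_sum:
  assumes sum: "triangle_sum x0 x1 g1 x0' x1' g2 \<epsilon> y0 y1 g" and "\<epsilon> > 0"
    and coeff1: "\<And>a b. coprime a b \<Longrightarrow> supporting_line x0 x1 g1 a b (\<gamma> a b)"
    and coeff2: "\<And>a b. coprime a b \<Longrightarrow> supporting_line x0' x1' g2 a b (\<delta> a b)"
  shows "((\<lambda>s. (defect \<gamma> s + \<epsilon> * defect \<delta> s)\<^sup>2) has_sum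
    2 * measure lborel (g_triangle y0 y1 g)) unimodular_rows"
proof -
  have "((\<lambda>s. (defect (\<lambda>a b. \<gamma> a b + \<epsilon> * \<delta> a b) s)\<^sup>2) has_sum
      2 * measure lborel (g_triangle y0 y1 g)) unimodular_rows"
    using sum triangle_sum_supporting_line[OF sum \<open>\<epsilon> > 0\<close> coeff1 coeff2]
    by (intro has_sum_defect_square) (auto simp: triangle_sum_def)
  moreover have "defect (\<lambda>a b. \<gamma> a b + \<epsilon> * \<delta> a b) s = defect \<gamma> s + \<epsilon> * defect \<delta> s" for s
    by (cases s) (simp add: defect_def algebra_simps)
  ultimately show ?thesis by simp
qed

lemma has_sum_mult_polarization:
  fixes f h :: "'a \<Rightarrow> real"
  assumes "((\<lambda>s. (f s)\<^sup>2) has_sum A) I" "((\<lambda>s. (h s)\<^sup>2) has_sum B) I"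
    and "((\<lambda>s. (f s + h s)\<^sup>2) has_sum C) I"
  shows "((\<lambda>s. f s * h s) has_sum (C - A - B) / 2) I"
proof -
  have "f s * h s = (1 / 2) * ((f s + h s)\<^sup>2 + (- (f s)\<^sup>2 + - (h s)\<^sup>2))" for s
    by (simp add: power2_sum)
  moreover have "(C - A - B) / 2 = (1 / 2) * (C + (- A + - B))"
    by simp
  ultimately show ?thesis
    by (simp only:) (intro has_sum_cmult_right has_sum_add has_sum_uminusI assms)
qed

lemma has_sum_square_add:
  fixes f h :: "'a \<Rightarrow> real"
  assumes "((\<lambda>s. (f s)\<^sup>2) has_sum A) I" "((\<lambda>s. f s * h s) has_sum M) I"
    and "((\<lambda>s. (h s)\<^sup>2) has_sum B) I"
  shows "((\<lambda>s. (f s + \<epsilon> * h s)\<^sup>2) has_sum A + 2 * \<epsilon> * M + \<epsilon>\<^sup>2 * B) I"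
proof -
  have "((\<lambda>s. (f s)\<^sup>2 + 2 * \<epsilon> * (f s * h s) + \<epsilon>\<^sup>2 * (h s)\<^sup>2) has_sum A + 2 * \<epsilon> * M + \<epsilon>\<^sup>2 * B) I"
    by (intro has_sum_add has_sum_cmult_right assms)
  then show ?thesis
    by (simp add: power2_sum power_mult_distrib algebra_simps)
qed

lemma has_mixed_area_coeff:
  assumes "triangle_function x0 x1 g1" "triangle_function x0' x1' g2"
    and "\<And>\<epsilon> y0 y1 g. \<lbrakk>triangle_sum x0 x1 g1 x0' x1' g2 \<epsilon> y0 y1 g; \<epsilon> > 0\<rbrakk> \<Longrightarrow>
      measure lborel (g_triangle y0 y1 g) = poly p \<epsilon>"
  shows "has_mixed_area x0 x1 g1 x0' x1' g2 (coeff p 1)"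
  unfolding has_mixed_area_def using ex_triangle_sum[OF assms(1,2)] assms(3)
  by (intro exI[of _ p]) metis

theorem theorem7:
  fixes g1 g2 :: "real \<Rightarrow> real" and x0 x1 x0' x1' :: real
    and \<gamma> \<delta> :: "nat \<Rightarrow> nat \<Rightarrow> real"
  assumes "triangle_function x0 x1 g1"
    and "triangle_function x0' x1' g2"
    and "\<And>a b. coprime a b \<Longrightarrow> supporting_line x0 x1 g1 a b (\<gamma> a b)"
    and "\<And>a b. coprime a b \<Longrightarrow> supporting_line x0' x1' g2 a b (\<delta> a b)"
  shows "\<exists>M. has_mixed_area x0 x1 g1 x0' x1' g2 M \<and>
    ((\<lambda>(a, b, c, d). (\<gamma> a b + \<gamma> c d - \<gamma> (a + c) (b + d)) * (\<delta> a b + \<delta> c d - \<delta> (a + c) (b + d)))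
      has_sum M) {(a, b, c, d). int a * int d - int b * int c = 1}"
proof -
  define A where "A = measure lborel (g_triangle x0 x1 g1)"
  define B where "B = measure lborel (g_triangle x0' x1' g2)"
  note squares = has_sum_defect_square[OF assms(1,3), folded A_def]
    has_sum_defect_square[OF assms(2,4), folded B_def]
  obtain y0 y1 g where "triangle_sum x0 x1 g1 x0' x1' g2 1 y0 y1 g"
    using ex_triangle_sum[OF assms(1,2) zero_less_one] by blast
  from has_sum_defect_square_triangle_sum[OF this zero_less_one assms(3,4)]
  obtain M where mixed: "((\<lambda>s. defect \<gamma> s * defect \<delta> s) has_sum M) unimodular_rows"
    using has_sum_mult_polarization[OF squares] by auto
  have "measure lborel (g_triangle y0 y1 g) = poly [:A, M, B:] \<epsilon>"
    if "triangle_sum x0 x1 g1 x0' x1' g2 \<epsilon> y0 y1 g" "\<epsilon> > 0" for \<epsilon> y0 y1 g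
    using has_sum_unique[OF has_sum_defect_square_triangle_sum[OF that assms(3,4)]
        has_sum_square_add[OF squares(1) mixed squares(2)]]
    by (simp add: power2_eq_square algebra_simps)
  then have "has_mixed_area x0 x1 g1 x0' x1' g2 M"
    using has_mixed_area_coeff[OF assms(1,2), of "[:A, M, B:]"] by simp
  with mixed show ?thesis
    by (auto simp: defect_def unimodular_rows_def case_prod_unfold)
qed

end
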